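(* Let $M$ be an infinite metric space (with an arbitrary distinguished base point $0\in M$). Then $\mathrm{Lip}_0(M)$ contains a subspace isometric to $\ell_\infty$. If moreover the completion of $M$ has an accumulation point or contains an infinite ultrametric space, then $\mathcal F(M)$ contains a $1$-complemented subspace isometric to $\ell_1$.
   Context: All Banach spaces are real, and $\ell_1,\ell_\infty$ are the usual real sequence spaces with their canonical norms. Let $(M,\rho,0)$ be a pointed metric space, i.e. a metric space with a distinguished base point $0\in M$. $\mathrm{Lip}_0(M)$ is the Banach space of all real-valued Lipschitz functions $f$ on $M$ with $f(0)=0$, equipped with the norm $\|f\|_{\mathrm{Lip}}=\sup\left\{\frac{|f(x)-f(y)|}{\rho(x,y)} : x,y\in M,\ x\neq y\right\}$. For $x\in M$ let $\delta_x\in \mathrm{Lip}_0(M)^*$ be the evaluation functional $\langle\delta_x,f\rangle=f(x)$. The Lipschitz-free space $\mathcal F(M)$ is the closed linear span of $\{\delta_x : x\in M\}$ in $\mathrm{Lip}_0(M)^*$, with the dual norm. (Up to linear isometry, $\mathrm{Lip}_0(M)$ and $\mathcal F(M)$ do not depend on the choice of base point.) "Isometric" for Banach spaces means linearly isometric. A subspace $Y$ of a Banach space $X$ is $1$-complemented if it is the range of a linear projection of $X$ of norm $1$. An ultrametric space is a metric space $(N,\rho)$ with $\rho(x,y)\le\max\{\rho(x,z),\rho(z,y)\}$ for all $x,y,z\in N$; a metric space contains an ultrametric space if some subset with the restricted metric is an ultrametric space. *)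

theory Defs
  imports "HOL-Analysis.Analysis"
begin

text \<open>The distinguished base point is \<open>0\<close>; no axiom relates it to the metric.\<close>

class pointed_metric_space = metric_space + zero

typedef (overloaded) ('a::pointed_metric_space) lip0 =
  "{f :: 'a \<Rightarrow> real. f 0 = 0 \<and> (\<exists>C. C-lipschitz_on UNIV f)}"
  morphisms apply_lip0 Lip0
  by (rule exI[of _ "\<lambda>_. 0"]) (auto intro!: exI[of _ 0] lipschitz_onI)

setup_lifting type_definition_lip0

lemma lip0_eqI: "(\<And>x. apply_lip0 f x = apply_lip0 g x) \<Longrightarrow> f = g"
  by transfer auto

lemma apply_lip0_base [simp]: "apply_lip0 f 0 = 0"
  by transfer auto

instantiation lip0 :: (pointed_metric_space) real_vector
begin

lift_definition zero_lip0 :: "'a lip0" is "\<lambda>_. 0"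
  by (auto intro!: exI[of _ 0] lipschitz_onI)

lift_definition plus_lip0 :: "'a lip0 \<Rightarrow> 'a lip0 \<Rightarrow> 'a lip0" is "\<lambda>f g x. f x + g x"
  by (auto intro: lipschitz_on_add)

lift_definition uminus_lip0 :: "'a lip0 \<Rightarrow> 'a lip0" is "\<lambda>f x. - f x"
  by auto

lift_definition minus_lip0 :: "'a lip0 \<Rightarrow> 'a lip0 \<Rightarrow> 'a lip0" is "\<lambda>f g x. f x - g x"
  by (auto intro: lipschitz_on_diff)

lift_definition scaleR_lip0 :: "real \<Rightarrow> 'a lip0 \<Rightarrow> 'a lip0" is "\<lambda>r f x. r * f x"
  by (auto intro: lipschitz_on_cmult_real)

instance
  by standard (transfer; simp add: algebra_simps)+

end

lemmas [simp] =
  zero_lip0.rep_eq plus_lip0.rep_eq uminus_lip0.rep_eq minus_lip0.rep_eq scaleR_lip0.rep_eq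

instantiation lip0 :: (pointed_metric_space) real_normed_vector
begin

text \<open>Inserting \<open>0\<close> matters only for a one-point space, where the set of difference
  quotients is empty.\<close>

definition norm_lip0 :: "'a lip0 \<Rightarrow> real" where
  "norm_lip0 f =
     Sup (insert 0 {\<bar>apply_lip0 f x - apply_lip0 f y\<bar> / dist x y | x y. x \<noteq> y})"

definition dist_lip0 :: "'a lip0 \<Rightarrow> 'a lip0 \<Rightarrow> real" where
  "dist_lip0 f g = norm (f - g)"

definition sgn_lip0 :: "'a lip0 \<Rightarrow> 'a lip0" where
  "sgn_lip0 f = f /\<^sub>R norm f"

definition uniformity_lip0 :: "('a lip0 \<times> 'a lip0) filter" where
  "uniformity_lip0 = (INF e\<in>{0<..}. principal {(f, g). dist f g < e})"

definition open_lip0 :: "'a lip0 set \<Rightarrow> bool" where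
  "open_lip0 S = (\<forall>f\<in>S. \<forall>\<^sub>F (f', g) in uniformity. f' = f \<longrightarrow> g \<in> S)"

lemma lip0_bdd_above:
  "bdd_above (insert 0 {\<bar>apply_lip0 f x - apply_lip0 f y\<bar> / dist x y | x y. x \<noteq> y})"
proof -
  obtain C where C: "C-lipschitz_on UNIV (apply_lip0 f)"
    using apply_lip0[of f] by auto
  have "\<bar>apply_lip0 f x - apply_lip0 f y\<bar> / dist x y \<le> C" if "x \<noteq> y" for x y
    using lipschitz_onD[OF C, of x y] that by (simp add: dist_real_def divide_le_eq)
  then show ?thesis
    using lipschitz_on_nonneg[OF C] by (intro bdd_aboveI[of _ C]) auto
qed

lemma norm_lip0_nonneg: "0 \<le> norm (f :: 'a lip0)"
  unfolding norm_lip0_def by (rule cSup_upper[OF _ lip0_bdd_above]) simp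

lemma lip0_norm_bound: "\<bar>apply_lip0 f x - apply_lip0 f y\<bar> \<le> norm f * dist x y"
proof (cases "x = y")
  case False
  then have "\<bar>apply_lip0 f x - apply_lip0 f y\<bar> / dist x y \<le> norm f"
    unfolding norm_lip0_def by (intro cSup_upper[OF _ lip0_bdd_above]) auto
  with False show ?thesis by (simp add: divide_le_eq)
qed simp

lemma lip0_norm_le:
  assumes "0 \<le> C" "\<And>x y. \<bar>apply_lip0 f x - apply_lip0 f y\<bar> \<le> C * dist x y"
  shows "norm f \<le> C"
  unfolding norm_lip0_def
  by (rule cSup_least) (use assms in \<open>auto simp: divide_le_eq\<close>)

lemma lip0_abs_le: "\<bar>apply_lip0 f x\<bar> \<le> norm f * dist x 0"
  using lip0_norm_bound[of f x 0] by simp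

lemma norm_lip0_scaleR_le: "norm (a *\<^sub>R f) \<le> \<bar>a\<bar> * norm (f :: 'a lip0)"
proof (rule lip0_norm_le)
  show "0 \<le> \<bar>a\<bar> * norm f" by (simp add: norm_lip0_nonneg)
  fix x y
  have "\<bar>apply_lip0 (a *\<^sub>R f) x - apply_lip0 (a *\<^sub>R f) y\<bar>
      = \<bar>a\<bar> * \<bar>apply_lip0 f x - apply_lip0 f y\<bar>"
    by (simp add: abs_mult flip: right_diff_distrib)
  also have "\<dots> \<le> \<bar>a\<bar> * (norm f * dist x y)"
    by (intro mult_left_mono lip0_norm_bound) simp
  finally show "\<bar>apply_lip0 (a *\<^sub>R f) x - apply_lip0 (a *\<^sub>R f) y\<bar> \<le> \<bar>a\<bar> * norm f * dist x y"
    by (simp add: mult.assoc)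
qed

instance
proof
  fix a :: real and f g :: "'a lip0"
  have z: "norm (0 :: 'a lip0) \<le> 0"
    by (rule lip0_norm_le) auto
  show "(norm f = 0) = (f = 0)"
  proof
    assume "norm f = 0"
    then have "\<bar>apply_lip0 f x\<bar> \<le> 0" for x using lip0_abs_le[of f x] by simp
    then show "f = 0" by (intro lip0_eqI) simp
  qed (use z norm_lip0_nonneg[of "0 :: 'a lip0"] in auto)
  show "norm (f + g) \<le> norm f + norm g"
  proof (rule lip0_norm_le)
    fix x y
    show "\<bar>apply_lip0 (f + g) x - apply_lip0 (f + g) y\<bar> \<le> (norm f + norm g) * dist x y"
      using lip0_norm_bound[of f x y] lip0_norm_bound[of g x y]
      by (simp add: distrib_right)
  qed (simp add: norm_lip0_nonneg)
  show "norm (a *\<^sub>R f) = \<bar>a\<bar> * norm f"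
  proof (cases "a = 0")
    case False
    have "norm f = norm (inverse a *\<^sub>R a *\<^sub>R f)" using False by simp
    also have "\<dots> \<le> \<bar>inverse a\<bar> * norm (a *\<^sub>R f)" by (rule norm_lip0_scaleR_le)
    finally have "\<bar>a\<bar> * norm f \<le> norm (a *\<^sub>R f)"
      using False by (simp add: field_simps)
    with norm_lip0_scaleR_le[of a f] show ?thesis by simp
  qed (use z norm_lip0_nonneg[of "0 :: 'a lip0"] in auto)
qed (simp_all add: dist_lip0_def sgn_lip0_def uniformity_lip0_def open_lip0_def)

end

instance lip0 :: (pointed_metric_space) banach
proof
  fix X :: "nat \<Rightarrow> 'a lip0"
  assume X: "Cauchy X"
  have "Cauchy (\<lambda>n. apply_lip0 (X n) x)" for x
  proof (rule metric_CauchyI)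
    fix e :: real assume e: "0 < e"
    define d where "d = dist x 0 + 1"
    have d: "0 < d" "dist x 0 \<le> d" unfolding d_def by (simp_all add: add_nonneg_pos)
    obtain N where N: "\<And>m n. m \<ge> N \<Longrightarrow> n \<ge> N \<Longrightarrow> norm (X m - X n) < e / d"
      using CauchyD[OF X, of "e / d"] e d by auto
    have "dist (apply_lip0 (X m) x) (apply_lip0 (X n) x) < e" if "m \<ge> N" "n \<ge> N" for m n
    proof -
      have "dist (apply_lip0 (X m) x) (apply_lip0 (X n) x) \<le> norm (X m - X n) * dist x 0"
        using lip0_abs_le[of "X m - X n" x] by (simp add: dist_real_def)
      also have "\<dots> \<le> norm (X m - X n) * d" using d by (intro mult_left_mono) auto
      also have "\<dots> < e" using N[OF that] d by (simp add: field_simps)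
      finally show ?thesis .
    qed
    then show "\<exists>N. \<forall>m\<ge>N. \<forall>n\<ge>N. dist (apply_lip0 (X m) x) (apply_lip0 (X n) x) < e"
      by blast
  qed
  then have "\<exists>l. (\<lambda>n. apply_lip0 (X n) x) \<longlonglongrightarrow> l" for x
    by (simp add: Cauchy_convergent_iff convergent_def)
  then obtain l where l: "\<And>x. (\<lambda>n. apply_lip0 (X n) x) \<longlonglongrightarrow> l x" by metis
  obtain B where B: "\<And>n. norm (X n) \<le> B"
    using cauchy_imp_bounded[OF X] by (auto simp: bounded_iff)
  have B0: "0 \<le> B" using B[of 0] norm_ge_zero[of "X 0"] by linarith
  have "\<bar>l x - l y\<bar> \<le> B * dist x y" for x y
  proof (rule LIMSEQ_le_const2)
    show "(\<lambda>n. \<bar>apply_lip0 (X n) x - apply_lip0 (X n) y\<bar>) \<longlonglongrightarrow> \<bar>l x - l y\<bar>"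
      by (intro tendsto_intros l)
    have "\<bar>apply_lip0 (X n) x - apply_lip0 (X n) y\<bar> \<le> B * dist x y" for n
      by (rule order_trans[OF lip0_norm_bound mult_right_mono[OF B]]) simp
    then show "\<exists>N. \<forall>n\<ge>N. \<bar>apply_lip0 (X n) x - apply_lip0 (X n) y\<bar> \<le> B * dist x y" by blast
  qed
  then have "B-lipschitz_on UNIV l"
    by (intro lipschitz_onI) (auto simp: dist_real_def B0)
  moreover have "l 0 = 0" using LIMSEQ_unique[OF l[of 0]] by simp
  ultimately have ap: "apply_lip0 (Lip0 l) = l" by (intro Lip0_inverse) auto
  have "X \<longlonglongrightarrow> Lip0 l"
  proof (rule LIMSEQ_I)
    fix e :: real assume e: "0 < e"
    obtain N where N: "\<And>m n. m \<ge> N \<Longrightarrow> n \<ge> N \<Longrightarrow> norm (X m - X n) < e / 2"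
      using CauchyD[OF X, of "e / 2"] e by auto
    have "norm (X n - Lip0 l) \<le> e / 2" if n: "n \<ge> N" for n
    proof (rule lip0_norm_le)
      fix x y
      show "\<bar>apply_lip0 (X n - Lip0 l) x - apply_lip0 (X n - Lip0 l) y\<bar> \<le> e / 2 * dist x y"
      proof (rule LIMSEQ_le_const2)
        show "(\<lambda>m. \<bar>apply_lip0 (X n - X m) x - apply_lip0 (X n - X m) y\<bar>)
            \<longlonglongrightarrow> \<bar>apply_lip0 (X n - Lip0 l) x - apply_lip0 (X n - Lip0 l) y\<bar>"
          by (simp add: ap) (intro tendsto_intros l)
        have "\<bar>apply_lip0 (X n - X m) x - apply_lip0 (X n - X m) y\<bar> \<le> e / 2 * dist x y"
          if "m \<ge> N" for m
          by (rule order_trans[OF lip0_norm_bound mult_right_mono])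
            (use N[OF n that] in auto)
        then show "\<exists>M. \<forall>m\<ge>M. \<bar>apply_lip0 (X n - X m) x - apply_lip0 (X n - X m) y\<bar>
            \<le> e / 2 * dist x y" by blast
      qed
    qed (use e in simp)
    moreover have "e / 2 < e" using e by simp
    ultimately show "\<exists>N. \<forall>n\<ge>N. norm (X n - Lip0 l) < e"
      by (meson le_less_trans)
  qed
  then show "convergent X" by (rule convergentI)
qed

lift_definition eval_lip0 :: "'a::pointed_metric_space \<Rightarrow> ('a lip0 \<Rightarrow>\<^sub>L real)"
  is "\<lambda>x f. apply_lip0 f x"
proof -
  fix x :: 'a
  show "bounded_linear (\<lambda>f. apply_lip0 f x)"
    by (rule bounded_linear_intro[where K = "dist x 0"]) (auto intro: lip0_abs_le)
qed

typedef (overloaded) ('a::pointed_metric_space) lip_free =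
  "closure (span (range eval_lip0)) :: ('a lip0 \<Rightarrow>\<^sub>L real) set"
  morphisms functional_of Lip_free
  using span_zero closure_subset by blast

setup_lifting type_definition_lip_free

lemma subspace_closure:
  fixes S :: "'b::real_normed_vector set"
  assumes S: "subspace S"
  shows "subspace (closure S)"
proof (rule subspaceI)
  show "0 \<in> closure S" using subspace_0[OF S] closure_subset by auto
next
  fix x y assume "x \<in> closure S" "y \<in> closure S"
  then obtain f g where f: "\<And>n. f n \<in> S" "f \<longlonglongrightarrow> x" and g: "\<And>n. g n \<in> S" "g \<longlonglongrightarrow> y"
    unfolding closure_sequential by blast
  have "\<forall>n. f n + g n \<in> S" using f g subspace_add[OF S] by blast
  moreover have "(\<lambda>n. f n + g n) \<longlonglongrightarrow> x + y" by (intro tendsto_add f g)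
  ultimately show "x + y \<in> closure S"
    unfolding closure_sequential by (intro exI[of _ "\<lambda>n. f n + g n"] conjI)
next
  fix c :: real and x assume "x \<in> closure S"
  then obtain f where f: "\<And>n. f n \<in> S" "f \<longlonglongrightarrow> x"
    unfolding closure_sequential by blast
  have "\<forall>n. c *\<^sub>R f n \<in> S" using f subspace_scale[OF S] by blast
  moreover have "(\<lambda>n. c *\<^sub>R f n) \<longlonglongrightarrow> c *\<^sub>R x" by (intro tendsto_intros f)
  ultimately show "c *\<^sub>R x \<in> closure S"
    unfolding closure_sequential by (intro exI[of _ "\<lambda>n. c *\<^sub>R f n"] conjI)
qed

lemma subspace_closure_span_eval:
  "subspace (closure (span (range (eval_lip0 :: 'a::pointed_metric_space \<Rightarrow> _))))"
  by (intro subspace_closure subspace_span)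

instantiation lip_free :: (pointed_metric_space) real_vector
begin

lift_definition zero_lip_free :: "'a lip_free" is 0
  by (rule subspace_0[OF subspace_closure_span_eval])

lift_definition plus_lip_free :: "'a lip_free \<Rightarrow> 'a lip_free \<Rightarrow> 'a lip_free" is "(+)"
  by (rule subspace_add[OF subspace_closure_span_eval])

lift_definition uminus_lip_free :: "'a lip_free \<Rightarrow> 'a lip_free" is uminus
  by (rule subspace_neg[OF subspace_closure_span_eval])

lift_definition minus_lip_free :: "'a lip_free \<Rightarrow> 'a lip_free \<Rightarrow> 'a lip_free" is "(-)"
  by (rule subspace_diff[OF subspace_closure_span_eval])

lift_definition scaleR_lip_free :: "real \<Rightarrow> 'a lip_free \<Rightarrow> 'a lip_free" is "(*\<^sub>R)"
  by (rule subspace_scale[OF subspace_closure_span_eval])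

instance
  by standard (transfer; simp add: algebra_simps)+

end

instantiation lip_free :: (pointed_metric_space) real_normed_vector
begin

lift_definition norm_lip_free :: "'a lip_free \<Rightarrow> real" is norm .

lift_definition dist_lip_free :: "'a lip_free \<Rightarrow> 'a lip_free \<Rightarrow> real" is dist .

lift_definition sgn_lip_free :: "'a lip_free \<Rightarrow> 'a lip_free" is sgn
  by (simp add: sgn_div_norm subspace_scale[OF subspace_closure_span_eval])

definition uniformity_lip_free :: "('a lip_free \<times> 'a lip_free) filter" where
  "uniformity_lip_free = (INF e\<in>{0<..}. principal {(u, v). dist u v < e})"

definition open_lip_free :: "'a lip_free set \<Rightarrow> bool" where
  "open_lip_free S = (\<forall>u\<in>S. \<forall>\<^sub>F (u', v) in uniformity. u' = u \<longrightarrow> v \<in> S)"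

instance
proof
  fix a :: real and u v :: "'a lip_free"
  show "dist u v = norm (u - v)" by transfer (simp add: dist_norm)
  show "sgn u = u /\<^sub>R norm u" by transfer (simp add: sgn_div_norm)
  show "(norm u = 0) = (u = 0)" by transfer simp
  show "norm (u + v) \<le> norm u + norm v" by transfer (rule norm_triangle_ineq)
  show "norm (a *\<^sub>R u) = \<bar>a\<bar> * norm u" by transfer simp
qed (simp_all add: uniformity_lip_free_def open_lip_free_def)

end

instance lip_free :: (pointed_metric_space) banach
proof
  fix X :: "nat \<Rightarrow> 'a lip_free"
  assume "Cauchy X"
  then have "Cauchy (\<lambda>n. functional_of (X n))"
    by (simp add: Cauchy_def dist_lip_free.rep_eq)
  then obtain l where l: "(\<lambda>n. functional_of (X n)) \<longlonglongrightarrow> l"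
    by (auto simp: Cauchy_convergent_iff convergent_def)
  have "l \<in> closure (span (range eval_lip0))"
    by (rule closed_sequentially[OF closed_closure _ l]) (rule functional_of)
  then have "functional_of (Lip_free l) = l" by (rule Lip_free_inverse)
  with l have "X \<longlonglongrightarrow> Lip_free l"
    by (simp add: lim_sequentially dist_lip_free.rep_eq)
  then show "convergent X" by (rule convergentI)
qed

text \<open>The completion is realised as the closure of the image of the Kuratowski embedding
  \<open>x \<mapsto> (y \<mapsto> dist x y - dist 0 y)\<close> into the bounded continuous functions. The lemmas
  \<open>dist_to_completion\<close> and \<open>dense_to_completion\<close>, together with the \<open>complete_space\<close>
  instance, characterise it up to isometry.\<close>

definition kuratowski :: "'a::pointed_metric_space \<Rightarrow> ('a \<Rightarrow>\<^sub>C real)" where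
  "kuratowski x = Bcontfun (\<lambda>y. dist x y - dist 0 y)"

lemma apply_kuratowski: "apply_bcontfun (kuratowski x) y = dist x y - dist 0 y"
proof -
  have "(\<lambda>y. dist x y - dist 0 y) \<in> bcontfun"
  proof (rule bcontfun_normI[where b = "dist x 0"])
    show "norm (dist x y - dist 0 y) \<le> dist x 0" for y
      using abs_dist_diff_le[of x y 0] by (simp add: dist_commute[of y 0])
  qed (intro continuous_intros)
  then show ?thesis by (simp add: kuratowski_def Bcontfun_inverse)
qed

lemma dist_kuratowski: "dist (kuratowski x) (kuratowski y) = dist x y"
proof (rule antisym)
  show "dist (kuratowski x) (kuratowski y) \<le> dist x y"
  proof (rule dist_bound)
    fix z
    have "\<bar>dist x z - dist y z\<bar> \<le> dist x y"
      using abs_dist_diff_le[of x z y] by (simp only: dist_commute[of z y])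
    then show "dist (kuratowski x z) (kuratowski y z) \<le> dist x y"
      by (simp add: apply_kuratowski dist_real_def)
  qed
  show "dist x y \<le> dist (kuratowski x) (kuratowski y)"
    using dist_bounded[of "kuratowski x" y "kuratowski y"]
    by (simp add: apply_kuratowski dist_real_def)
qed

typedef (overloaded) ('a::pointed_metric_space) completion =
  "closure (range (kuratowski :: 'a \<Rightarrow> _))"
  by (rule exI[of _ "kuratowski 0"]) (rule subsetD[OF closure_subset rangeI])

setup_lifting type_definition_completion

instantiation completion :: (pointed_metric_space) metric_space
begin

lift_definition dist_completion :: "'a completion \<Rightarrow> 'a completion \<Rightarrow> real" is dist .

definition uniformity_completion :: "('a completion \<times> 'a completion) filter" where
  "uniformity_completion = (INF e\<in>{0<..}. principal {(p, q). dist p q < e})"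

definition open_completion :: "'a completion set \<Rightarrow> bool" where
  "open_completion S = (\<forall>p\<in>S. \<forall>\<^sub>F (p', q) in uniformity. p' = p \<longrightarrow> q \<in> S)"

instance
proof
  fix p q r :: "'a completion"
  show "(dist p q = 0) = (p = q)" by transfer simp
  show "dist p q \<le> dist p r + dist q r" by transfer (rule dist_triangle2)
qed (simp_all add: uniformity_completion_def open_completion_def)

end

instance completion :: (pointed_metric_space) complete_space
proof
  fix X :: "nat \<Rightarrow> 'a completion"
  assume "Cauchy X"
  then have "Cauchy (\<lambda>n. Rep_completion (X n))"
    by (simp add: Cauchy_def dist_completion.rep_eq)
  then obtain l where l: "(\<lambda>n. Rep_completion (X n)) \<longlonglongrightarrow> l"
    by (auto simp: Cauchy_convergent_iff convergent_def)
  have "l \<in> closure (range kuratowski)"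
    by (rule closed_sequentially[OF closed_closure _ l]) (rule Rep_completion)
  then have "Rep_completion (Abs_completion l) = l" by (rule Abs_completion_inverse)
  with l have "X \<longlonglongrightarrow> Abs_completion l"
    by (simp add: lim_sequentially dist_completion.rep_eq)
  then show "convergent X" by (rule convergentI)
qed

lift_definition to_completion :: "'a::pointed_metric_space \<Rightarrow> 'a completion" is kuratowski
  by (rule subsetD[OF closure_subset rangeI])

lemma dist_to_completion: "dist (to_completion x) (to_completion y) = dist x y"
  by transfer (rule dist_kuratowski)

lemma dense_to_completion:
  "closure (range (to_completion :: 'a::pointed_metric_space \<Rightarrow> _)) = UNIV"
proof -
  have "\<exists>x. dist (to_completion x) p < e" if "0 < e" for p :: "'a completion" and e :: real
    using that by transfer (auto simp: closure_approachable)
  then show ?thesis by (auto simp: closure_approachable)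
qed

definition ultrametric_on :: "'a::metric_space set \<Rightarrow> bool" where
  "ultrametric_on S \<longleftrightarrow> (\<forall>x\<in>S. \<forall>y\<in>S. \<forall>z\<in>S. dist x y \<le> max (dist x z) (dist z y))"

text \<open>Every function on the discrete space \<^typ>\<open>nat\<close> is continuous, so these are exactly
  the bounded sequences, with the supremum norm.\<close>

type_synonym ell_inf = "nat \<Rightarrow>\<^sub>C real"

typedef ell1 = "{a :: nat \<Rightarrow> real. summable (\<lambda>n. \<bar>a n\<bar>)}"
  morphisms ell1_nth Ell1
  by (rule exI[of _ "\<lambda>_. 0"]) simp

setup_lifting type_definition_ell1

instantiation ell1 :: real_vector
begin

lemma summable_abs_add:
  fixes a b :: "nat \<Rightarrow> real"
  assumes "summable (\<lambda>n. \<bar>a n\<bar>)" "summable (\<lambda>n. \<bar>b n\<bar>)"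
  shows "summable (\<lambda>n. \<bar>a n + b n\<bar>)"
  by (rule summable_comparison_test'[OF summable_add[OF assms], of 0])
    (simp add: abs_triangle_ineq)

lift_definition zero_ell1 :: ell1 is "\<lambda>_. 0" by simp

lift_definition plus_ell1 :: "ell1 \<Rightarrow> ell1 \<Rightarrow> ell1" is "\<lambda>a b n. a n + b n"
  by (rule summable_abs_add)

lift_definition uminus_ell1 :: "ell1 \<Rightarrow> ell1" is "\<lambda>a n. - a n" by simp

lift_definition minus_ell1 :: "ell1 \<Rightarrow> ell1 \<Rightarrow> ell1" is "\<lambda>a b n. a n - b n"
  subgoal for a b using summable_abs_add[of a "\<lambda>n. - b n"] by simp
  done

lift_definition scaleR_ell1 :: "real \<Rightarrow> ell1 \<Rightarrow> ell1" is "\<lambda>r a n. r * a n"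
  by (simp add: abs_mult summable_mult)

instance
  by standard (transfer; simp add: algebra_simps)+

end

instantiation ell1 :: real_normed_vector
begin

lift_definition norm_ell1 :: "ell1 \<Rightarrow> real" is "\<lambda>a. \<Sum>n. \<bar>a n\<bar>" .

definition dist_ell1 :: "ell1 \<Rightarrow> ell1 \<Rightarrow> real" where
  "dist_ell1 a b = norm (a - b)"

definition sgn_ell1 :: "ell1 \<Rightarrow> ell1" where
  "sgn_ell1 a = a /\<^sub>R norm a"

definition uniformity_ell1 :: "(ell1 \<times> ell1) filter" where
  "uniformity_ell1 = (INF e\<in>{0<..}. principal {(a, b). dist a b < e})"

definition open_ell1 :: "ell1 set \<Rightarrow> bool" where
  "open_ell1 S = (\<forall>a\<in>S. \<forall>\<^sub>F (a', b) in uniformity. a' = a \<longrightarrow> b \<in> S)"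

instance
proof
  fix r :: real and a b :: ell1
  show "(norm a = 0) = (a = 0)" by transfer (auto simp: suminf_eq_zero_iff)
  show "norm (a + b) \<le> norm a + norm b"
  proof transfer
    fix a b :: "nat \<Rightarrow> real"
    assume ab: "summable (\<lambda>n. \<bar>a n\<bar>)" "summable (\<lambda>n. \<bar>b n\<bar>)"
    have "summable (\<lambda>n. \<bar>a n + b n\<bar>)"
      by (rule summable_abs_add[OF ab])
    then have "(\<Sum>n. \<bar>a n + b n\<bar>) \<le> (\<Sum>n. \<bar>a n\<bar> + \<bar>b n\<bar>)"
      by (intro suminf_le abs_triangle_ineq summable_add ab)
    then show "(\<Sum>n. \<bar>a n + b n\<bar>) \<le> (\<Sum>n. \<bar>a n\<bar>) + (\<Sum>n. \<bar>b n\<bar>)"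
      by (simp add: suminf_add ab)
  qed
  show "norm (r *\<^sub>R a) = \<bar>r\<bar> * norm a" by transfer (simp add: abs_mult suminf_mult)
qed (simp_all add: dist_ell1_def sgn_ell1_def uniformity_ell1_def open_ell1_def)

end

definition isometric_to ::
  "'x::real_normed_vector set \<Rightarrow> 'y::real_normed_vector itself \<Rightarrow> bool" where
  "isometric_to Y (_ :: 'y itself) \<longleftrightarrow>
     (\<exists>T :: 'y \<Rightarrow> 'x. linear T \<and> (\<forall>v. norm (T v) = norm v) \<and> range T = Y)"

definition one_complemented :: "'x::real_normed_vector set \<Rightarrow> bool" where
  "one_complemented Y \<longleftrightarrow>
     (\<exists>P :: 'x \<Rightarrow>\<^sub>L 'x. P o\<^sub>L P = P \<and> norm P = 1 \<and> range (blinfun_apply P) = Y)"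

end

theory Submission
  imports Defs "HOL-Complex_Analysis.Great_Picard"
begin

text \<open>
  The functions and the molecules come from one geometric configuration. Consider balls with
  centres \<open>z\<^sub>i\<close> and radii \<open>r\<^sub>i \<ge> 0\<close> such that \<open>r\<^sub>i + r\<^sub>j \<le> dist z\<^sub>i z\<^sub>j\<close> for
  \<open>i \<noteq> j\<close>. The bumps \<open>x \<mapsto> max 0 (r\<^sub>i - dist x z\<^sub>i)\<close> then have disjoint supports, and every
  combination of them with coefficients in \<open>[-1, 1]\<close> is 1-Lipschitz
  (\<open>superposition_lipschitz\<close>). If the balls come in pairs (dipoles) with centres \<open>p\<^sub>n\<close>,
  \<open>q\<^sub>n\<close> whose radii add up to at least \<open>(1 - \<epsilon>\<^sub>n) * dist p\<^sub>n q\<^sub>n\<close>, the difference of the two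
  bumps of a pair nearly attains the slope \<open>1\<close> between \<open>p\<^sub>n\<close> and \<open>q\<^sub>n\<close>.

  If \<open>\<epsilon>\<^sub>n\<close> tends to \<open>0\<close>, repeating each coefficient on infinitely many dipoles embeds
  \<open>\<ell>\<^sub>\<infinity>\<close> isometrically into the Lipschitz functions (\<open>dipole_system_imp_ell_inf\<close>). If all
  \<open>\<epsilon>\<^sub>n\<close> are \<open>0\<close>, the dipole functions are biorthogonal to the normalised differences of
  evaluations at \<open>p\<^sub>n\<close> and \<open>q\<^sub>n\<close>, and these span a 1-complemented copy of \<open>\<ell>\<^sub>1\<close>
  (\<open>dipole_system_imp_ell1\<close>).

  It remains to find dipoles. Every bounded infinite set contains a sequence of distinct points
  \<open>x\<^sub>i\<close> such that \<open>dist x\<^sub>i x\<^sub>j\<close> tends to some \<open>l\<^sub>i\<close> as \<open>j\<close> grows, and \<open>l\<^sub>i\<close> tends to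
  some \<open>L\<close>. The right radii are \<open>l\<^sub>i - L / 2\<close>: pairs at distance smaller than the sum of these
  radii give exact dipoles after both radii are lowered by half of the excess, and if no such pairs exist far
  out, the radii themselves can be used, with \<open>\<epsilon>\<^sub>n\<close> as small as desired
  (\<open>dipole_system_exists\<close>). They give exact dipoles if \<open>dist x\<^sub>i x\<^sub>j\<close> never exceeds the sum of the
  radii. This is so for Cauchy sequences, where it is the triangle inequality through the limit
  in the completion, and in ultrametric spaces. Unbounded sets allow direct constructions with
  points very far from each other. Finally, an accumulation point of the completion provides a
  Cauchy sequence of distinct points in the space, and without one the space coincides with its
  completion, so that an ultrametric subset of the completion is a subset of the space.
\<close>

section \<open>Superpositions of bumps\<close>

text \<open>A pair stands for the open ball with its first component as centre and its second one as
  radius. Balls that are apart are disjoint; a ball of radius \<open>0\<close> is apart from itself.\<close>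

definition apart :: "'a::metric_space \<times> real \<Rightarrow> 'a \<times> real \<Rightarrow> bool" where
  "apart \<beta> \<gamma> \<longleftrightarrow> snd \<beta> + snd \<gamma> \<le> dist (fst \<beta>) (fst \<gamma>)"

lemma apart_sym: "apart \<beta> \<gamma> \<longleftrightarrow> apart \<gamma> \<beta>"
  by (simp add: apart_def add.commute dist_commute)

definition packing :: "('i \<Rightarrow> 'a::metric_space \<times> real) \<Rightarrow> bool" where
  "packing \<beta> \<longleftrightarrow> (\<forall>i. 0 \<le> snd (\<beta> i)) \<and> (\<forall>i j. i \<noteq> j \<longrightarrow> apart (\<beta> i) (\<beta> j))"

definition bump :: "'a::metric_space \<times> real \<Rightarrow> 'a \<Rightarrow> real" where
  "bump \<beta> x = max 0 (snd \<beta> - dist x (fst \<beta>))"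

lemma bump_lipschitz: "\<bar>bump \<beta> x - bump \<beta> y\<bar> \<le> dist x y"
  using dist_triangle[of x "fst \<beta>" y] dist_triangle[of y "fst \<beta>" x]
  by (auto simp: bump_def dist_commute)

text \<open>If \<open>x\<close> and \<open>y\<close> lie in balls that are apart, the path from one centre to the other
  through \<open>x\<close> and \<open>y\<close> is at least as long as the two radii together. So the heights of two
  bumps can be added, even with opposite signs, without the slope exceeding \<open>1\<close>.\<close>

lemma apart_bumps_le:
  assumes "apart \<beta> \<gamma>" "bump \<beta> x \<noteq> 0" "bump \<gamma> y \<noteq> 0"
  shows "\<bar>bump \<beta> x\<bar> + \<bar>bump \<gamma> y\<bar> \<le> dist x y"
proof -
  have "dist (fst \<beta>) (fst \<gamma>) \<le> dist x (fst \<beta>) + dist x y + dist y (fst \<gamma>)"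
    using dist_triangle[of "fst \<beta>" "fst \<gamma>" x] dist_triangle[of x "fst \<gamma>" y]
    by (simp add: dist_commute)
  with assms show ?thesis
    by (auto simp: bump_def apart_def max_def split: if_splits)
qed

text \<open>The summation runs over the bumps that do not vanish at \<open>x\<close>. For a packing there is at most
  one, so no question of convergence arises and arbitrary index types are allowed.\<close>

definition superposition ::
  "('i \<Rightarrow> 'a::metric_space \<times> real) \<Rightarrow> ('i \<Rightarrow> real) \<Rightarrow> 'a \<Rightarrow> real" where
  "superposition \<beta> c x = (\<Sum>i | bump (\<beta> i) x \<noteq> 0. c i * bump (\<beta> i) x)"

lemma superposition_outside:
  assumes "\<And>i. bump (\<beta> i) x = 0"
  shows "superposition \<beta> c x = 0"
  by (simp add: superposition_def assms)

lemma superposition_inside: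
  assumes "packing \<beta>" "bump (\<beta> i) x \<noteq> 0"
  shows "superposition \<beta> c x = c i * bump (\<beta> i) x"
proof -
  have "j = i" if "bump (\<beta> j) x \<noteq> 0" for j
    using assms apart_bumps_le[of "\<beta> j" "\<beta> i" x x] that by (force simp: packing_def)
  then have "{j. bump (\<beta> j) x \<noteq> 0} = {i}" using assms(2) by blast
  then show ?thesis by (simp add: superposition_def)
qed

lemma superposition_centre:
  assumes "packing \<beta>"
  shows "superposition \<beta> c (fst (\<beta> i)) = c i * snd (\<beta> i)"
proof (cases "snd (\<beta> i) = 0")
  case True
  have "bump (\<beta> j) (fst (\<beta> i)) = 0" for j
  proof (cases "j = i")
    case False
    then have "apart (\<beta> i) (\<beta> j)" using assms by (simp add: packing_def)
    then show ?thesis using True by (simp add: bump_def apart_def)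
  qed (simp add: bump_def True)
  then show ?thesis using True by (simp add: superposition_outside)
next
  case False
  moreover have "0 \<le> snd (\<beta> i)" using assms by (simp add: packing_def)
  ultimately show ?thesis
    using superposition_inside[OF assms, of i "fst (\<beta> i)"] by (simp add: bump_def)
qed

lemma superposition_add:
  "superposition \<beta> (\<lambda>i. c i + e i) x = superposition \<beta> c x + superposition \<beta> e x"
  by (simp add: superposition_def distrib_right sum.distrib)

lemma superposition_scale: "superposition \<beta> (\<lambda>i. k * c i) x = k * superposition \<beta> c x"
  by (simp add: superposition_def sum_distrib_left mult.assoc)

text \<open>Two points in the same ball (or one in it and one in no ball) see a single bump of slope at
  most \<open>C\<close>; two points in different balls are handled by \<open>apart_bumps_le\<close>. This is what makes
  the supremum norm of the coefficients bound the Lipschitz constant, whatever the signs.\<close>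

lemma superposition_lipschitz:
  assumes \<beta>: "packing \<beta>" and c: "\<And>i. \<bar>c i\<bar> \<le> C" and C: "0 \<le> C"
  shows "\<bar>superposition \<beta> c x - superposition \<beta> c y\<bar> \<le> C * dist x y"
proof -
  have one: "\<bar>c i * bump (\<beta> i) x - c i * bump (\<beta> i) y\<bar> \<le> C * dist x y" for i x y
    unfolding right_diff_distrib[symmetric] abs_mult
    by (intro mult_mono c C bump_lipschitz) simp
  have within: "\<bar>superposition \<beta> c x - superposition \<beta> c y\<bar> \<le> C * dist x y"
    if "bump (\<beta> i) x \<noteq> 0" "\<And>j. bump (\<beta> j) y \<noteq> 0 \<Longrightarrow> j = i" for i x y
  proof -
    have "superposition \<beta> c y = c i * bump (\<beta> i) y"
    proof (cases "bump (\<beta> i) y = 0")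
      case True
      then have "superposition \<beta> c y = 0" using that(2) by (metis superposition_outside)
      then show ?thesis using True by simp
    next
      case False
      then show ?thesis by (rule superposition_inside[OF \<beta>])
    qed
    then show ?thesis
      using one[of i x y] superposition_inside[OF \<beta> that(1)] by simp
  qed
  consider "\<And>i. bump (\<beta> i) x = 0" "\<And>i. bump (\<beta> i) y = 0"
    | i where "bump (\<beta> i) x \<noteq> 0" "\<And>j. bump (\<beta> j) y \<noteq> 0 \<Longrightarrow> j = i"
    | i where "bump (\<beta> i) y \<noteq> 0" "\<And>j. bump (\<beta> j) x \<noteq> 0 \<Longrightarrow> j = i"
    | i j where "i \<noteq> j" "bump (\<beta> i) x \<noteq> 0" "bump (\<beta> j) y \<noteq> 0"
    by metis
  then show ?thesis
  proof cases
    case 1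
    then show ?thesis using C by (simp add: superposition_outside)
  next
    case 2
    then show ?thesis by (rule within)
  next
    case 3
    from within[OF this] show ?thesis by (simp add: abs_minus_commute dist_commute)
  next
    case (4 i j)
    have "\<bar>c i * bump (\<beta> i) x - c j * bump (\<beta> j) y\<bar>
        \<le> \<bar>c i\<bar> * \<bar>bump (\<beta> i) x\<bar> + \<bar>c j\<bar> * \<bar>bump (\<beta> j) y\<bar>"
      using abs_triangle_ineq4[of "c i * bump (\<beta> i) x" "c j * bump (\<beta> j) y"]
      by (simp add: abs_mult)
    also have "\<dots> \<le> C * \<bar>bump (\<beta> i) x\<bar> + C * \<bar>bump (\<beta> j) y\<bar>"
      by (intro add_mono mult_right_mono c) auto
    also have "\<dots> \<le> C * dist x y"
      unfolding distrib_left[symmetric]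
      using \<beta> 4 by (intro mult_left_mono apart_bumps_le C) (auto simp: packing_def)
    finally show ?thesis
      using superposition_inside[OF \<beta> 4(2)] superposition_inside[OF \<beta> 4(3)] by simp
  qed
qed

section \<open>Dipoles and copies of \<open>\<ell>\<^sub>\<infinity>\<close>\<close>

text \<open>The bump on the first ball minus the bump on the second one varies between the two centres by
  the sum of the radii. This is at most their distance because the balls are apart, and
  \<open>\<epsilon>\<close> measures how far it is from attaining norm \<open>1\<close> there.\<close>

definition dipole :: "real \<Rightarrow> (bool \<Rightarrow> 'a::metric_space \<times> real) \<Rightarrow> bool" where
  "dipole \<epsilon> D \<longleftrightarrow> fst (D True) \<noteq> fst (D False) \<and> (\<forall>b. 0 \<le> snd (D b)) \<and>
     apart (D True) (D False) \<and>
     (1 - \<epsilon>) * dist (fst (D True)) (fst (D False)) \<le> snd (D True) + snd (D False)"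

definition dipole_system :: "(nat \<Rightarrow> real) \<Rightarrow> (nat \<Rightarrow> bool \<Rightarrow> 'a::metric_space \<times> real) \<Rightarrow> bool" where
  "dipole_system \<epsilon> D \<longleftrightarrow> (\<forall>n. dipole (\<epsilon> n) (D n)) \<and> (\<forall>m n b c. m < n \<longrightarrow> apart (D m b) (D n c))"

lemma packing_dipole_system:
  assumes "dipole_system \<epsilon> D"
  shows "packing (case_prod D)"
proof -
  have ne: "apart (D m b) (D n c)" if "m \<noteq> n" for m n b c
    using assms that apart_sym unfolding dipole_system_def by (metis nat_neq_iff)
  have eq: "apart (D n b) (D n c)" if "b \<noteq> c" for n b c
    using assms that apart_sym[of "D n True" "D n False"] unfolding dipole_system_def dipole_def
    by (cases b; cases c) auto
  have "apart (case_prod D i) (case_prod D j)" if "i \<noteq> j" for i j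
    using ne eq that by (cases i; cases j; cases "fst i = fst j") auto
  moreover have "0 \<le> snd (case_prod D i)" for i
    using assms by (auto simp: dipole_system_def dipole_def split: prod.split)
  ultimately show ?thesis by (auto simp: packing_def)
qed

definition dipole_coeff :: "(nat \<Rightarrow> real) \<Rightarrow> nat \<times> bool \<Rightarrow> real" where
  "dipole_coeff a = (\<lambda>(n, b). if b then a n else - a n)"

text \<open>Subtracting the value at the base point changes no difference, hence no norm.\<close>

definition dipole_lip ::
  "(nat \<Rightarrow> bool \<Rightarrow> 'a::pointed_metric_space \<times> real) \<Rightarrow> (nat \<Rightarrow> real) \<Rightarrow> 'a lip0" where
  "dipole_lip D a = Lip0 (\<lambda>x. superposition (case_prod D) (dipole_coeff a) x
                            - superposition (case_prod D) (dipole_coeff a) 0)"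

context
  fixes \<epsilon> :: "nat \<Rightarrow> real" and D :: "nat \<Rightarrow> bool \<Rightarrow> 'a::pointed_metric_space \<times> real"
  assumes D: "dipole_system \<epsilon> D"
begin

lemma superposition_dipole_lipschitz:
  assumes "\<And>n. \<bar>a n\<bar> \<le> C"
  shows "\<bar>superposition (case_prod D) (dipole_coeff a) x
        - superposition (case_prod D) (dipole_coeff a) y\<bar> \<le> C * dist x y"
proof (rule superposition_lipschitz[OF packing_dipole_system[OF D]])
  show "\<bar>dipole_coeff a i\<bar> \<le> C" for i
    using assms by (auto simp: dipole_coeff_def split: prod.split)
  show "0 \<le> C" using assms[of 0] by linarith
qed

lemma apply_dipole_lip:
  assumes "bounded (range a)"
  shows "apply_lip0 (dipole_lip D a) x = superposition (case_prod D) (dipole_coeff a) x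
                            - superposition (case_prod D) (dipole_coeff a) 0"
proof -
  obtain C where C: "\<And>n. \<bar>a n\<bar> \<le> C" using assms by (auto simp: bounded_iff)
  then have "0 \<le> C" using C[of 0] by linarith
  then have "C-lipschitz_on UNIV (\<lambda>x. superposition (case_prod D) (dipole_coeff a) x
                            - superposition (case_prod D) (dipole_coeff a) 0)"
    by (intro lipschitz_onI) (use superposition_dipole_lipschitz[OF C] in \<open>auto simp: dist_real_def\<close>)
  then show ?thesis unfolding dipole_lip_def by (subst Lip0_inverse) auto
qed

lemma norm_dipole_lip_le:
  assumes "\<And>n. \<bar>a n\<bar> \<le> C"
  shows "norm (dipole_lip D a) \<le> C"
proof (rule lip0_norm_le)
  show "0 \<le> C" using assms[of 0] by linarith
  have "bounded (range a)" using assms by (auto simp: bounded_iff)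
  then show "\<bar>apply_lip0 (dipole_lip D a) x - apply_lip0 (dipole_lip D a) y\<bar> \<le> C * dist x y" for x y
    using superposition_dipole_lipschitz[OF assms, where x = x and y = y] by (simp add: apply_dipole_lip)
qed

lemma dipole_lip_difference:
  assumes "bounded (range a)"
  shows "apply_lip0 (dipole_lip D a) (fst (D n True)) - apply_lip0 (dipole_lip D a) (fst (D n False))
    = a n * (snd (D n True) + snd (D n False))"
  using superposition_centre[OF packing_dipole_system[OF D], of "dipole_coeff a" "(n, True)"]
    superposition_centre[OF packing_dipole_system[OF D], of "dipole_coeff a" "(n, False)"]
  by (simp add: apply_dipole_lip[OF assms] dipole_coeff_def algebra_simps)

lemma dipole_lip_add:
  assumes "bounded (range a)" "bounded (range e)"
  shows "dipole_lip D (\<lambda>n. a n + e n) = dipole_lip D a + dipole_lip D e"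
proof (rule lip0_eqI)
  have "bounded (range (\<lambda>n. a n + e n))" using assms by (rule bounded_plus_comp)
  moreover have "dipole_coeff (\<lambda>n. a n + e n) = (\<lambda>i. dipole_coeff a i + dipole_coeff e i)"
    by (auto simp: dipole_coeff_def)
  ultimately show "apply_lip0 (dipole_lip D (\<lambda>n. a n + e n)) x
      = apply_lip0 (dipole_lip D a + dipole_lip D e) x" for x
    by (simp add: apply_dipole_lip assms superposition_add)
qed

lemma dipole_lip_scale:
  assumes "bounded (range a)"
  shows "dipole_lip D (\<lambda>n. k * a n) = k *\<^sub>R dipole_lip D a"
proof (rule lip0_eqI)
  have "bounded (range (\<lambda>n. k * a n))"
    using bounded_scaleR_comp[OF assms, of k] by simp
  moreover have "dipole_coeff (\<lambda>n. k * a n) = (\<lambda>i. k * dipole_coeff a i)"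
    by (auto simp: dipole_coeff_def)
  ultimately show "apply_lip0 (dipole_lip D (\<lambda>n. k * a n)) x = apply_lip0 (k *\<^sub>R dipole_lip D a) x" for x
    by (simp add: apply_dipole_lip assms superposition_scale algebra_simps)
qed

text \<open>A single dipole function is only known to have norm at least \<open>1 - \<epsilon> n\<close>. Using each coefficient for an
  infinite family of dipoles makes the defects disappear in the supremum.\<close>

lemma dipole_system_imp_ell_inf:
  assumes \<epsilon>: "\<epsilon> \<longlonglongrightarrow> 0"
  shows "\<exists>Y :: 'a lip0 set. subspace Y \<and> isometric_to Y TYPE(ell_inf)"
proof -
  \<comment> \<open>All dipoles with the same \<open>\<kappa>\<close> receive the same coefficient.\<close>
  define \<kappa> where "\<kappa> = (\<lambda>n. fst (prod_decode n))"
  define T :: "ell_inf \<Rightarrow> 'a lip0" where "T = (\<lambda>a. dipole_lip D (\<lambda>n. apply_bcontfun a (\<kappa> n)))"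
  have bdd: "bounded (range (\<lambda>n. apply_bcontfun a (\<kappa> n)))" for a :: ell_inf
    using norm_bounded[of a] by (auto simp: bounded_iff)
  have lin: "linear T"
  proof (rule linearI)
    show "T (a + e) = T a + T e" for a e
      unfolding T_def by (simp add: plus_bcontfun.rep_eq dipole_lip_add bdd)
    show "T (k *\<^sub>R a) = k *\<^sub>R T a" for k a
      unfolding T_def by (simp add: scaleR_bcontfun.rep_eq dipole_lip_scale bdd)
  qed
  have "norm (T a) = norm a" for a
  proof (rule antisym)
    show "norm (T a) \<le> norm a"
      unfolding T_def by (rule norm_dipole_lip_le) (use norm_bounded[of a] in auto)
    show "norm a \<le> norm (T a)"
    proof (rule norm_bound)
      fix k
      let ?n = "\<lambda>j. prod_encode (k, j)"
      have "(1 - \<epsilon> (?n j)) * \<bar>apply_bcontfun a k\<bar> \<le> norm (T a)" for j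
      proof -
        let ?D = "D (?n j)"
        let ?d = "dist (fst (?D True)) (fst (?D False))"
        have dip: "dipole (\<epsilon> (?n j)) ?D" using D by (simp add: dipole_system_def)
        have "\<bar>apply_bcontfun a k\<bar> * ((1 - \<epsilon> (?n j)) * ?d)
            \<le> \<bar>apply_bcontfun a k\<bar> * (snd (?D True) + snd (?D False))"
          using dip by (intro mult_left_mono) (auto simp: dipole_def)
        also have "\<dots> = \<bar>apply_lip0 (T a) (fst (?D True)) - apply_lip0 (T a) (fst (?D False))\<bar>"
          using dip unfolding T_def dipole_lip_difference[OF bdd]
          by (simp add: \<kappa>_def abs_mult dipole_def)
        also have "\<dots> \<le> norm (T a) * ?d" by (rule lip0_norm_bound)
        finally have "((1 - \<epsilon> (?n j)) * \<bar>apply_bcontfun a k\<bar>) * ?d \<le> norm (T a) * ?d"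
          by (simp add: mult_ac)
        moreover have "0 < ?d" using dip by (simp add: dipole_def)
        ultimately show ?thesis by (rule mult_right_le_imp_le)
      qed
      moreover have "(\<lambda>j. (1 - \<epsilon> (?n j)) * \<bar>apply_bcontfun a k\<bar>) \<longlonglongrightarrow> (1 - 0) * \<bar>apply_bcontfun a k\<bar>"
      proof (intro tendsto_intros filterlim_compose[OF \<epsilon>])
        show "filterlim ?n at_top sequentially"
          by (rule filterlim_at_top_mono[OF filterlim_ident]) (simp add: le_prod_encode_2)
      qed
      ultimately show "norm (apply_bcontfun a k) \<le> norm (T a)"
        by (intro LIMSEQ_le_const2[where a = "norm (T a)"]) auto
    qed
  qed
  then have "isometric_to (range T) TYPE(ell_inf)"
    unfolding isometric_to_def using lin by blast
  moreover have "subspace (range T)" using lin by (intro linear_subspace_image) auto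
  ultimately show ?thesis by blast
qed

end

section \<open>Complemented copies of \<open>\<ell>\<^sub>1\<close>\<close>

text \<open>The bound on the functionals makes \<open>u \<mapsto> (\<phi> n u)\<^sub>n\<close> a contraction \<open>Q\<close> into
  \<open>\<ell>\<^sub>1\<close>, and \<open>b \<mapsto> \<Sum>n. b n *\<^sub>R m n\<close> is a contraction \<open>J\<close> back. Biorthogonality gives
  \<open>Q \<circ> J = id\<close>, so \<open>J\<close> is an isometry and \<open>J \<circ> Q\<close> is a projection onto its range.\<close>

lemma biorthogonal_imp_one_complemented_ell1:
  fixes \<phi> :: "nat \<Rightarrow> 'x::banach \<Rightarrow> real" and m :: "nat \<Rightarrow> 'x"
  assumes lin: "\<And>n. linear (\<phi> n)"
    and sum: "\<And>u N. (\<Sum>n<N. \<bar>\<phi> n u\<bar>) \<le> norm u"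
    and m: "\<And>n. norm (m n) \<le> 1"
    and biorth: "\<And>k n. \<phi> k (m n) = (if k = n then 1 else 0)"
  shows "\<exists>Y :: 'x set. subspace Y \<and> isometric_to Y TYPE(ell1) \<and> one_complemented Y"
proof -
  have \<phi>_le: "\<bar>\<phi> n u\<bar> \<le> norm u" for n u
  proof -
    have "0 \<le> (\<Sum>k<n. \<bar>\<phi> k u\<bar>)" by (intro sum_nonneg) simp
    then show ?thesis using sum[of u "Suc n"] unfolding sum.lessThan_Suc by linarith
  qed
  have blin: "bounded_linear (\<phi> n)" for n
    using lin[of n] \<phi>_le by (intro bounded_linear_intro[where K = 1]) (auto simp: linear_iff)
  have \<phi>_summable: "summable (\<lambda>n. \<bar>\<phi> n u\<bar>)" for u
    by (rule summableI_nonneg_bounded[OF _ sum]) simp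
  define Q where "Q = (\<lambda>u. Ell1 (\<lambda>n. \<phi> n u))"
  have Q_nth: "ell1_nth (Q u) n = \<phi> n u" for u n
    by (simp add: Q_def Ell1_inverse \<phi>_summable)
  have Q_add: "Q (u + v) = Q u + Q v" for u v
    by (intro ell1_nth_inject[THEN iffD1] ext)
      (simp add: Q_nth plus_ell1.rep_eq linear_add[OF lin])
  have Q_scale: "Q (k *\<^sub>R u) = k *\<^sub>R Q u" for k u
    by (intro ell1_nth_inject[THEN iffD1] ext)
      (simp add: Q_nth scaleR_ell1.rep_eq linear_scale[OF lin])
  have Q_norm: "norm (Q u) \<le> norm u" for u
    unfolding norm_ell1.rep_eq Q_nth by (rule suminf_le_const[OF \<phi>_summable sum])
  define J where "J = (\<lambda>b. \<Sum>n. ell1_nth b n *\<^sub>R m n)"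
  have term_le: "norm (ell1_nth b n *\<^sub>R m n) \<le> \<bar>ell1_nth b n\<bar>" for b n
    using mult_left_mono[OF m[of n], of "\<bar>ell1_nth b n\<bar>"] by simp
  have abs_summable: "summable (\<lambda>n. \<bar>ell1_nth b n\<bar>)" for b
    using ell1_nth[of b] by simp
  have J_summable: "summable (\<lambda>n. ell1_nth b n *\<^sub>R m n)" for b
    by (rule summable_comparison_test'[OF abs_summable term_le])
  have J_norm: "norm (J b) \<le> norm b" for b
    unfolding J_def norm_ell1.rep_eq by (rule norm_suminf_le[OF term_le abs_summable])
  have J_lin: "linear J"
  proof (rule linearI)
    show "J (b + c) = J b + J c" for b c
      unfolding J_def
      by (simp add: plus_ell1.rep_eq scaleR_add_left suminf_add[OF J_summable J_summable])
    show "J (k *\<^sub>R b) = k *\<^sub>R J b" for k b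
      unfolding J_def
      by (simp add: scaleR_ell1.rep_eq suminf_scaleR_right[OF J_summable] flip: scaleR_scaleR)
  qed
  have QJ: "Q (J b) = b" for b
  proof (intro ell1_nth_inject[THEN iffD1] ext)
    fix k
    have "\<phi> k (J b) = (\<Sum>n. \<phi> k (ell1_nth b n *\<^sub>R m n))"
      unfolding J_def by (rule bounded_linear.suminf[OF blin J_summable])
    also have "\<dots> = (\<Sum>n. if n = k then ell1_nth b n else 0)"
      by (intro suminf_cong) (simp add: linear_scale[OF lin] biorth)
    also have "\<dots> = ell1_nth b k"
      using sums_single[of k "ell1_nth b"] by (simp add: sums_iff)
    finally show "ell1_nth (Q (J b)) k = ell1_nth b k" by (simp add: Q_nth)
  qed
  have isometry: "norm (J b) = norm b" for b
    using J_norm[of b] Q_norm[of "J b"] by (simp add: QJ)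
  define P where "P = Blinfun (J \<circ> Q)"
  have PQ_norm: "norm (J (Q u)) \<le> norm u" for u
    using Q_norm by (simp add: isometry)
  have "bounded_linear (J \<circ> Q)"
    by (rule bounded_linear_intro[where K = 1])
      (auto simp: Q_add Q_scale linear_add[OF J_lin] linear_scale[OF J_lin] PQ_norm)
  then have P: "blinfun_apply P u = J (Q u)" for u
    by (simp add: P_def bounded_linear_Blinfun_apply)
  have "one_complemented (range J)"
    unfolding one_complemented_def
  proof (intro exI conjI)
    show "P o\<^sub>L P = P" by (rule blinfun_eqI) (simp add: P QJ)
    have "1 \<le> norm P"
    proof -
      have "Q (m 0) \<noteq> 0" using Q_nth[of "m 0" 0] by (auto simp: biorth zero_ell1.rep_eq)
      then have "0 < norm (J (Q (m 0)))" by (simp add: isometry)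
      moreover have "norm (J (Q (m 0))) \<le> norm P * norm (J (Q (m 0)))"
        using norm_blinfun[of P "J (Q (m 0))"] by (simp add: P QJ)
      ultimately show ?thesis by simp
    qed
    moreover have "norm P \<le> 1" by (rule norm_blinfun_bound) (simp_all add: P PQ_norm)
    ultimately show "norm P = 1" by simp
    show "range (blinfun_apply P) = range J"
      by (metis (no_types, lifting) P QJ image_eqI rangeE rangeI subsetI subset_antisym)
  qed
  moreover have "isometric_to (range J) TYPE(ell1)"
    unfolding isometric_to_def using J_lin isometry by blast
  moreover have "subspace (range J)" using J_lin by (intro linear_subspace_image) auto
  ultimately show ?thesis by blast
qed

text \<open>With defect \<open>0\<close> the \<open>n\<close>th dipole function attains its norm at the molecule
  \<open>(\<delta>\<^sub>p - \<delta>\<^sub>q) / dist p q\<close> of its two centres and vanishes at the other molecules. The sum of the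
  absolute values of the pairings with \<open>u\<close> is the pairing of \<open>u\<close> with a superposition with
  coefficients \<open>\<plusminus>1\<close> or \<open>0\<close>, which has norm at most \<open>1\<close>.\<close>

lemma dipole_system_imp_ell1:
  fixes D :: "nat \<Rightarrow> bool \<Rightarrow> 'a::pointed_metric_space \<times> real"
  assumes D: "dipole_system (\<lambda>_. 0) D"
  shows "\<exists>Y :: 'a lip_free set. subspace Y \<and> isometric_to Y TYPE(ell1) \<and> one_complemented Y"
proof -
  define p q d where "p = (\<lambda>n. fst (D n True))" and "q = (\<lambda>n. fst (D n False))"
    and "d = (\<lambda>n. dist (p n) (q n))"
  have d_pos: "0 < d n" for n
    using D by (simp add: p_def q_def d_def dipole_system_def dipole_def)
  have d_eq: "snd (D n True) + snd (D n False) = d n" for n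
    using D by (auto simp: p_def q_def d_def dipole_system_def dipole_def apart_def intro: antisym)
  define e :: "nat \<Rightarrow> nat \<Rightarrow> real" where "e = (\<lambda>n k. if k = n then 1 else 0)"
  have bdd_e: "bounded (range (e n))" for n
    by (auto simp: bounded_iff e_def intro: exI[of _ 1])
  define \<phi> where "\<phi> = (\<lambda>n u. blinfun_apply (functional_of u) (dipole_lip D (e n)))"
  define \<mu> where "\<mu> = (\<lambda>n. (1 / d n) *\<^sub>R (eval_lip0 (p n) - eval_lip0 (q n)))"
  define m where "m = (\<lambda>n. Lip_free (\<mu> n))"
  have "\<mu> n \<in> span (range eval_lip0)" for n
    unfolding \<mu>_def by (intro span_scale span_diff span_base) auto
  then have m_inv: "functional_of (m n) = \<mu> n" for n
    unfolding m_def by (intro Lip_free_inverse subsetD[OF closure_subset])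
  have \<mu>: "blinfun_apply (\<mu> n) f = (apply_lip0 f (p n) - apply_lip0 f (q n)) / d n" for n f
    by (simp add: \<mu>_def eval_lip0.rep_eq blinfun.bilinear_simps)
  show ?thesis
  proof (rule biorthogonal_imp_one_complemented_ell1)
    show "linear (\<phi> n)" for n
      by (intro linearI)
        (simp_all add: \<phi>_def plus_lip_free.rep_eq scaleR_lip_free.rep_eq blinfun.bilinear_simps)
    show "norm (m n) \<le> 1" for n
      unfolding norm_lip_free.rep_eq m_inv
    proof (rule norm_blinfun_bound)
      show "norm (blinfun_apply (\<mu> n) f) \<le> 1 * norm f" for f
        using lip0_norm_bound[of f "p n" "q n"] d_pos[of n]
        by (simp add: \<mu> d_def divide_le_eq)
    qed simp
    show "\<phi> k (m n) = (if k = n then 1 else 0)" for k n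
      using dipole_lip_difference[OF D bdd_e, of k n] d_pos[of n]
      unfolding \<phi>_def m_inv \<mu> d_eq by (simp add: p_def q_def) (simp add: e_def)
    fix u :: "'a lip_free" and N
    define \<sigma> where "\<sigma> = (\<lambda>n. sgn (\<phi> n u))"
    have "(\<Sum>n<M. \<sigma> n *\<^sub>R dipole_lip D (e n)) = dipole_lip D (\<lambda>k. if k < M then \<sigma> k else 0)" for M
    proof (induction M)
      case 0
      show ?case using dipole_lip_scale[OF D bdd_e[of 0], of 0] by simp
    next
      case (Suc M)
      have "bounded (range (\<lambda>k. if k < M then \<sigma> k else 0))"
        by (auto simp: bounded_iff \<sigma>_def sgn_if intro: exI[of _ 1])
      moreover have "bounded (range (\<lambda>k. \<sigma> M * e M k))"
        by (auto simp: bounded_iff \<sigma>_def sgn_if e_def intro: exI[of _ 1])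
      moreover have "(\<lambda>k. if k < Suc M then \<sigma> k else 0)
          = (\<lambda>k. (if k < M then \<sigma> k else 0) + \<sigma> M * e M k)"
        by (rule ext) (simp add: e_def less_Suc_eq)
      ultimately show ?case
        using Suc by (simp add: dipole_lip_add[OF D] dipole_lip_scale[OF D bdd_e])
    qed
    then have norm_le: "norm (\<Sum>n<N. \<sigma> n *\<^sub>R dipole_lip D (e n)) \<le> 1"
      by (simp add: norm_dipole_lip_le[OF D] \<sigma>_def sgn_if)
    have "(\<Sum>n<N. \<bar>\<phi> n u\<bar>) = blinfun_apply (functional_of u) (\<Sum>n<N. \<sigma> n *\<^sub>R dipole_lip D (e n))"
      by (simp add: blinfun.sum_right blinfun.scaleR_right \<sigma>_def \<phi>_def abs_sgn mult.commute)
    also have "\<dots> \<le> norm (functional_of u) * norm (\<Sum>n<N. \<sigma> n *\<^sub>R dipole_lip D (e n))"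
      using norm_blinfun[of "functional_of u"] by (metis abs_le_D1 real_norm_def)
    also have "\<dots> \<le> norm u"
      using mult_left_mono[OF norm_le, of "norm (functional_of u)"] by (simp add: norm_lip_free.rep_eq)
    finally show "(\<Sum>n<N. \<bar>\<phi> n u\<bar>) \<le> norm u" .
  qed
qed

section \<open>Existence of dipole systems\<close>

lemma successive_choice:
  assumes step: "\<And>n F. finite F \<Longrightarrow> F \<subseteq> (\<Union>m. G m) \<Longrightarrow> \<exists>w\<in>G (n::nat). \<forall>v\<in>F. R v w"
  shows "\<exists>f. (\<forall>n. f n \<in> G n) \<and> (\<forall>m n. m < n \<longrightarrow> R (f m) (f n))"
proof -
  have "\<exists>f. \<forall>n. f n \<in> G n \<and> (\<forall>m<n. R (f m) (f n))"
  proof (rule dependent_wellorder_choice)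
    show "\<exists>r. r \<in> G n \<and> (\<forall>m<n. R (f m) r)"
      if "\<And>k. k < n \<Longrightarrow> f k \<in> G k \<and> (\<forall>m<k. R (f m) (f k))" for n f
    proof -
      have "f ` {..<n} \<subseteq> (\<Union>m. G m)" using that by blast
      then show ?thesis using step[of "f ` {..<n}" n] by fastforce
    qed
  qed auto
  then show ?thesis by blast
qed

text \<open>It suffices to find, for any finite collection of earlier dipoles, one more dipole that is
  apart from all of them; \<open>G\<close> may carry invariants that make this possible.\<close>

lemma dipole_system_by_choice:
  fixes G :: "nat \<Rightarrow> (bool \<Rightarrow> 'a::metric_space \<times> real) set"
  assumes dip: "\<And>n D. D \<in> G n \<Longrightarrow> dipole (\<epsilon> n) D"
    and step: "\<And>n F. finite F \<Longrightarrow> F \<subseteq> (\<Union>m. G m) \<Longrightarrow> \<exists>D\<in>G n. \<forall>E\<in>F. \<forall>b c. apart (E b) (D c)"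
  shows "\<exists>D :: nat \<Rightarrow> bool \<Rightarrow> 'a \<times> real. dipole_system \<epsilon> D"
proof -
  obtain f where f: "\<forall>n. f n \<in> G n" "\<forall>m n. m < n \<longrightarrow> (\<forall>b c. apart (f m b) (f n c))"
    using successive_choice[of G "\<lambda>E D. \<forall>b c. apart (E b) (D c)", OF step] by blast
  then have "dipole_system \<epsilon> f" using dip by (simp add: dipole_system_def)
  then show ?thesis by blast
qed

text \<open>Every bounded sequence of distinct points has a subsequence of this kind. The numbers
  \<open>l i\<close> and \<open>L\<close> are what is left of the metric in the limit.\<close>

locale settled_sequence =
  fixes x :: "nat \<Rightarrow> 'a::metric_space" and l :: "nat \<Rightarrow> real" and L :: real
  assumes inj: "inj x"
    and lim: "\<And>i. (\<lambda>j. dist (x i) (x j)) \<longlonglongrightarrow> l i"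
    and lim_lim: "l \<longlonglongrightarrow> L"
begin

text \<open>The point of these radii is that \<open>dist (x i) (x j) - rad j\<close> tends to
  \<open>rad i\<close>, so a ball around \<open>x i\<close> with a slightly smaller radius is apart from the ball of
  radius \<open>rad j\<close> around \<open>x j\<close> for all large \<open>j\<close>. For a Cauchy sequence \<open>rad i\<close> is the
  distance from \<open>x i\<close> to the limit in the completion; for an equidistant one it is half the
  common distance.\<close>

definition rad :: "nat \<Rightarrow> real" where "rad i = l i - L / 2"

lemma dist_le_l_add: "dist (x i) (x j) \<le> l i + l j"
proof (rule LIMSEQ_le_const[OF tendsto_add[OF lim[of i] lim[of j]]])
  show "\<exists>N. \<forall>k\<ge>N. dist (x i) (x j) \<le> dist (x i) (x k) + dist (x j) (x k)"
    by (metis dist_triangle2)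
qed

text \<open>In \<open>dist (x j) (x k) \<le> dist (x i) (x j) + dist (x i) (x k)\<close> let first \<open>k\<close>, then \<open>j\<close> tend to
  infinity.\<close>

lemma L_le: "L \<le> 2 * l i"
proof (rule LIMSEQ_le)
  show "(\<lambda>j. dist (x i) (x j) + l i) \<longlonglongrightarrow> 2 * l i"
    using tendsto_add[OF lim[of i] tendsto_const[of "l i"]] by simp
  have "l j \<le> dist (x i) (x j) + l i" for j
  proof (rule LIMSEQ_le[OF lim[of j] tendsto_add[OF tendsto_const lim[of i]]])
    show "\<exists>N. \<forall>k\<ge>N. dist (x j) (x k) \<le> dist (x i) (x j) + dist (x i) (x k)"
      by (metis dist_triangle3)
  qed
  then show "\<exists>N. \<forall>j\<ge>N. l j \<le> dist (x i) (x j) + l i" by blast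
qed (rule lim_lim)

lemma rad_nonneg: "0 \<le> rad i"
  using L_le[of i] by (simp add: rad_def)

text \<open>This keeps the radii nonnegative when both are lowered equally until they add up to the
  distance of the two points.\<close>

lemma abs_rad_diff_le: "\<bar>rad i - rad j\<bar> \<le> dist (x i) (x j)"
proof -
  have "(\<lambda>k. \<bar>dist (x i) (x k) - dist (x j) (x k)\<bar>) \<longlonglongrightarrow> \<bar>l i - l j\<bar>"
    by (intro tendsto_intros lim)
  moreover have "\<bar>dist (x i) (x k) - dist (x j) (x k)\<bar> \<le> dist (x i) (x j)" for k
    using abs_dist_diff_le[of "x i" "x k" "x j"] by (simp add: dist_commute)
  ultimately show ?thesis
    by (intro LIMSEQ_le_const2[where a = "dist (x i) (x j)"]) (auto simp: rad_def)
qed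

lemma lim_dist_minus_rad: "(\<lambda>j. dist (x i) (x j) - rad j) \<longlonglongrightarrow> rad i"
proof -
  have "(\<lambda>j. dist (x i) (x j) - (l j - L / 2)) \<longlonglongrightarrow> l i - (L - L / 2)"
    by (intro tendsto_intros lim lim_lim)
  then show ?thesis by (simp add: rad_def)
qed

text \<open>Dipoles of this kind can be collected one after another: the balls of a later one are
  contained in balls of radius \<open>rad\<close> far out in the sequence, and those are apart from
  the balls of all earlier ones.\<close>

definition admissible :: "nat \<Rightarrow> (bool \<Rightarrow> 'a \<times> real) \<Rightarrow> bool" where
  "admissible N D \<longleftrightarrow> (\<forall>b. \<exists>i\<ge>N. fst (D b) = x i \<and> snd (D b) \<le> rad i \<and>
     (\<forall>\<^sub>F k in sequentially. snd (D b) + rad k \<le> dist (x i) (x k)))"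

lemma admissible_dipoles_imp_system:
  assumes "\<And>n N. \<exists>D. dipole (\<epsilon> n) D \<and> admissible N D"
  shows "\<exists>D :: nat \<Rightarrow> bool \<Rightarrow> 'a \<times> real. dipole_system \<epsilon> D"
proof -
  let ?G = "\<lambda>n. {D. dipole (\<epsilon> n) D \<and> admissible 0 D}"
  show ?thesis
  proof (rule dipole_system_by_choice[of ?G])
    fix n F
    assume F: "finite F" "F \<subseteq> (\<Union>m. ?G m)"
    have "\<forall>\<^sub>F k in sequentially. snd (D b) + rad k \<le> dist (fst (D b)) (x k)" if "D \<in> F" for D b
    proof -
      have "admissible 0 D" using F(2) that by blast
      then show ?thesis unfolding admissible_def by metis
    qed
    then have "\<forall>\<^sub>F k in sequentially. \<forall>D\<in>F. \<forall>b\<in>UNIV. snd (D b) + rad k \<le> dist (fst (D b)) (x k)"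
      by (intro eventually_ball_finite F(1) ballI) auto
    then obtain N where N: "\<And>k D b. k \<ge> N \<Longrightarrow> D \<in> F \<Longrightarrow> snd (D b) + rad k \<le> dist (fst (D b)) (x k)"
      by (auto simp: eventually_sequentially)
    obtain D where D: "dipole (\<epsilon> n) D" "admissible N D" using assms by blast
    have "apart (E b) (D c)" if "E \<in> F" for E b c
    proof -
      obtain i where "i \<ge> N" "fst (D c) = x i" "snd (D c) \<le> rad i"
        using D(2) unfolding admissible_def by blast
      then show ?thesis using N[of i E b] that by (simp add: apart_def)
    qed
    moreover have "admissible 0 D" using D(2) by (fastforce simp: admissible_def)
    ultimately show "\<exists>D\<in>?G n. \<forall>E\<in>F. \<forall>b c. apart (E b) (D c)" using D(1) by blast
  qed simp
qed

text \<open>If \<open>l i = 0\<close>, the sequence converges to \<open>x i\<close>, which happens for at most one \<open>i\<close>.\<close>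

lemma eventually_pos_l: "\<exists>N. \<forall>i\<ge>N. 0 < l i"
proof -
  have nonneg: "0 \<le> l i" for i
    by (rule LIMSEQ_le_const[OF lim[of i]]) auto
  have "i = j" if "l i = 0" "l j = 0" for i j
    using dist_le_l_add[of i j] that inj by (simp add: inj_eq)
  then have "\<exists>N. \<forall>i\<ge>N. l i \<noteq> 0" by (metis Suc_n_not_le_n)
  then show ?thesis using nonneg by (metis less_eq_real_def)
qed

text \<open>If some pair far out satisfies \<open>dist (x i) (x j) < rad i + rad j\<close>, both radii are lowered by
  half of the excess; this gives an exact dipole, and the lower radii leave room for all
  late balls. Otherwise the balls of radius \<open>rad\<close> on the tail are already apart, and only the size
  of \<open>rad i + rad j\<close> is in question: it equals the distance under the second alternative of
  \<open>exact\<close>, and for fixed \<open>i\<close> with \<open>0 < l i\<close> its quotient by the distance tends to \<open>1\<close> as \<open>j\<close> grows.\<close>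

lemma dipole_system_exists:
  assumes \<epsilon>: "\<And>n. 0 \<le> \<epsilon> n"
    and exact: "(\<forall>n. 0 < \<epsilon> n) \<or> (\<forall>i j. i \<noteq> j \<longrightarrow> dist (x i) (x j) \<le> rad i + rad j)"
  shows "\<exists>D :: nat \<Rightarrow> bool \<Rightarrow> 'a \<times> real. dipole_system \<epsilon> D"
proof (rule admissible_dipoles_imp_system)
  fix n N
  show "\<exists>D. dipole (\<epsilon> n) D \<and> admissible N D"
  proof (cases "\<exists>i\<ge>N. \<exists>j>i. dist (x i) (x j) < rad i + rad j")
    case True
    then obtain i j where ij: "N \<le> i" "i < j" "dist (x i) (x j) < rad i + rad j" by blast
    define e where "e = (rad i + rad j - dist (x i) (x j)) / 2"
    have e: "0 < e" using ij(3) by (simp add: e_def)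
    define D where "D = (\<lambda>b. if b then (x i, rad i - e) else (x j, rad j - e))"
    have "x i \<noteq> x j" using inj ij(2) by (simp add: inj_eq)
    moreover have "0 \<le> rad i - e" "0 \<le> rad j - e"
      using abs_rad_diff_le[of i j] by (auto simp: e_def field_simps)
    moreover have "rad i - e + (rad j - e) = dist (x i) (x j)" by (simp add: e_def field_simps)
    moreover have "(1 - \<epsilon> n) * dist (x i) (x j) \<le> dist (x i) (x j)"
      using mult_right_mono[of "1 - \<epsilon> n" 1 "dist (x i) (x j)"] \<epsilon>[of n] by simp
    ultimately have "dipole (\<epsilon> n) D" by (simp add: dipole_def D_def apart_def)
    moreover have "\<forall>\<^sub>F k in sequentially. rad h - e + rad k \<le> dist (x h) (x k)" for h
      using order_tendstoD(1)[OF lim_dist_minus_rad[of h], of "rad h - e"] e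
      by (auto elim!: eventually_mono)
    then have "admissible N D"
      using ij e unfolding admissible_def D_def by (auto intro: exI[of _ i] exI[of _ j])
    ultimately show ?thesis by blast
  next
    case False
    have "\<exists>i\<ge>N. \<exists>j>i. (1 - \<epsilon> n) * dist (x i) (x j) \<le> rad i + rad j"
      using exact
    proof
      assume "\<forall>n. 0 < \<epsilon> n"
      obtain i where i: "N \<le> i" "0 < l i"
        using eventually_pos_l by (metis nat_le_linear)
      have "(\<lambda>j. rad i + (l j - L / 2) - (1 - \<epsilon> n) * dist (x i) (x j))
          \<longlonglongrightarrow> rad i + (L - L / 2) - (1 - \<epsilon> n) * l i"
        by (intro tendsto_intros lim lim_lim)
      moreover have "0 < rad i + (L - L / 2) - (1 - \<epsilon> n) * l i"
        using i(2) \<open>\<forall>n. 0 < \<epsilon> n\<close> by (simp add: rad_def algebra_simps)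
      ultimately have "\<forall>\<^sub>F j in sequentially. 0 < rad i + (l j - L / 2) - (1 - \<epsilon> n) * dist (x i) (x j)"
        by (rule order_tendstoD(1))
      then have "\<forall>\<^sub>F j in sequentially. (1 - \<epsilon> n) * dist (x i) (x j) < rad i + rad j"
        by eventually_elim (simp add: rad_def)
      then have "\<forall>\<^sub>F j in sequentially. (1 - \<epsilon> n) * dist (x i) (x j) < rad i + rad j \<and> i < j"
        using eventually_gt_at_top by (rule eventually_conj)
      then show ?thesis
        using i(1) eventually_happens'[OF sequentially_bot] by (metis (no_types, lifting) less_imp_le)
    next
      assume "\<forall>i j. i \<noteq> j \<longrightarrow> dist (x i) (x j) \<le> rad i + rad j"
      then have "dist (x N) (x (Suc N)) \<le> rad N + rad (Suc N)" by simp
      moreover have "(1 - \<epsilon> n) * dist (x N) (x (Suc N)) \<le> dist (x N) (x (Suc N))"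
        using mult_right_mono[of "1 - \<epsilon> n" 1 "dist (x N) (x (Suc N))"] \<epsilon>[of n] by simp
      ultimately show ?thesis by force
    qed
    then obtain i j where ij: "N \<le> i" "i < j" "(1 - \<epsilon> n) * dist (x i) (x j) \<le> rad i + rad j" by blast
    have far: "rad h + rad k \<le> dist (x h) (x k)" if "N \<le> h" "h < k" for h k
      using False that by force
    define D where "D = (\<lambda>b. if b then (x i, rad i) else (x j, rad j))"
    have "x i \<noteq> x j" using inj ij(2) by (simp add: inj_eq)
    then have "dipole (\<epsilon> n) D"
      using ij far by (simp add: dipole_def D_def apart_def rad_nonneg)
    moreover have "\<forall>\<^sub>F k in sequentially. rad h + rad k \<le> dist (x h) (x k)" if "N \<le> h" for h
      using eventually_gt_at_top[of h] by eventually_elim (use far that in auto)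
    then have "admissible N D"
      using ij unfolding admissible_def D_def by (auto intro: exI[of _ i] exI[of _ j])
    ultimately show ?thesis by blast
  qed
qed

text \<open>For \<open>L = 0\<close> this is the triangle inequality through the limit point in the completion.\<close>

lemma dist_le_rad_if_L_zero:
  assumes "L = 0"
  shows "dist (x i) (x j) \<le> rad i + rad j"
  using dist_le_l_add[of i j] assms unfolding rad_def by simp

text \<open>In the limit the ultrametric inequality reads \<open>dist (x i) (x j) \<le> max (l i) (l j)\<close> and
  \<open>L \<le> l i\<close>. The smaller one of \<open>l i\<close> and \<open>l j\<close> is therefore at least \<open>L\<close>, and the larger
  one is at most \<open>l i + l j - L = rad i + rad j\<close>.\<close>

lemma dist_le_rad_if_ultrametric:
  assumes "ultrametric_on (range x)"
  shows "dist (x i) (x j) \<le> rad i + rad j"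
proof -
  have um: "dist (x i) (x j) \<le> max (dist (x i) (x k)) (dist (x j) (x k))" for i j k
    using assms by (simp add: ultrametric_on_def dist_commute)
  have le_max: "dist (x i) (x j) \<le> max (l i) (l j)" for i j
    using um[of i j] by (intro LIMSEQ_le_const[OF tendsto_max[OF lim[of i] lim[of j]]]) auto
  have L_le: "L \<le> l i" for i
  proof (rule LIMSEQ_le[OF lim_lim])
    show "(\<lambda>j. max (dist (x i) (x j)) (l i)) \<longlonglongrightarrow> l i"
      using tendsto_max[OF lim[of i] tendsto_const[of "l i"]] by simp
    have "l j \<le> max (dist (x i) (x j)) (l i)" for j
      using um[of j _ i]
      by (intro LIMSEQ_le[OF lim[of j] tendsto_max[OF tendsto_const lim[of i]]])
        (auto simp: dist_commute)
    then show "\<exists>N. \<forall>j\<ge>N. l j \<le> max (dist (x i) (x j)) (l i)" by blast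
  qed
  show ?thesis using le_max[of i j] L_le[of i] L_le[of j] by (simp add: rad_def)
qed

end

text \<open>A diagonal argument makes all distances to a fixed term converge; a further subsequence makes
  these limits converge.\<close>

lemma settled_sequence_of_bounded:
  fixes S :: "'a::metric_space set"
  assumes S: "bounded S" "infinite S"
  shows "\<exists>x l L. settled_sequence x l L \<and> range x \<subseteq> S"
proof -
  obtain y :: "nat \<Rightarrow> 'a" where y: "inj y" "range y \<subseteq> S"
    using infinite_countable_subset[OF S(2)] by blast
  obtain M where M: "\<And>u v. u \<in> S \<Longrightarrow> v \<in> S \<Longrightarrow> dist u v \<le> M"
    using S(1) unfolding bounded_two_points by blast
  obtain r :: "nat \<Rightarrow> nat" where r: "strict_mono r"
    and "\<And>i. i \<in> UNIV \<Longrightarrow> \<exists>l. (\<lambda>n. dist (y i) (y (r n))) \<longlonglongrightarrow> l"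
  proof (rule function_convergent_subsequence[of UNIV "\<lambda>n i. dist (y i) (y n)" M])
    show "norm (dist (y i) (y n)) \<le> M" for i n using M[of "y i" "y n"] y(2) by auto
  qed auto
  then obtain l where l: "\<And>i. (\<lambda>n. dist (y i) (y (r n))) \<longlonglongrightarrow> l i" by (metis UNIV_I)
  have "0 \<le> l i" "l i \<le> M" for i
    using M[OF subsetD[OF y(2)] subsetD[OF y(2)]]
    by (auto intro!: LIMSEQ_le_const[OF l[of i]] LIMSEQ_le_const2[OF l[of i]])
  then have "bounded (range (l \<circ> r))"
    by (auto simp: bounded_iff intro: exI[of _ M])
  then obtain L s where s: "strict_mono (s :: nat \<Rightarrow> nat)" "((l \<circ> r) \<circ> s) \<longlonglongrightarrow> L"
    using bounded_imp_convergent_subsequence by blast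
  have "settled_sequence (y \<circ> (r \<circ> s)) ((l \<circ> r) \<circ> s) L"
  proof
    have "inj (r \<circ> s)" using r s(1) by (simp add: strict_mono_o strict_mono_imp_inj_on)
    then show "inj (y \<circ> (r \<circ> s))" using y(1) by (rule inj_compose[rotated])
    show "(\<lambda>j. dist ((y \<circ> (r \<circ> s)) i) ((y \<circ> (r \<circ> s)) j)) \<longlonglongrightarrow> ((l \<circ> r) \<circ> s) i" for i
      using LIMSEQ_subseq_LIMSEQ[OF l[of "r (s i)"] s(1)] by (simp add: o_def)
  qed (rule s(2))
  moreover have "range (y \<circ> (r \<circ> s)) \<subseteq> S" using y(2) by auto
  ultimately show ?thesis by blast
qed

text \<open>A Cauchy sequence is settled with \<open>L = 0\<close>.\<close>

lemma dipole_system_of_Cauchy: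
  fixes x :: "nat \<Rightarrow> 'a::metric_space"
  assumes "inj x" and C: "Cauchy x"
  shows "\<exists>D :: nat \<Rightarrow> bool \<Rightarrow> 'a \<times> real. dipole_system (\<lambda>_. 0) D"
proof -
  have "Cauchy (\<lambda>j. dist (x i) (x j))" for i
  proof (rule metric_CauchyI)
    fix e :: real assume "0 < e"
    then obtain N where N: "\<And>m n. N \<le> m \<Longrightarrow> N \<le> n \<Longrightarrow> dist (x m) (x n) < e"
      using metric_CauchyD[OF C] by blast
    have "dist (dist (x i) (x m)) (dist (x i) (x n)) < e" if "N \<le> m" "N \<le> n" for m n
      using N[OF that] abs_dist_diff_le[of "x m" "x i" "x n"]
      by (simp add: dist_real_def dist_commute)
    then show "\<exists>N. \<forall>m\<ge>N. \<forall>n\<ge>N. dist (dist (x i) (x m)) (dist (x i) (x n)) < e" by blast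
  qed
  then obtain l where l: "\<And>i. (\<lambda>j. dist (x i) (x j)) \<longlonglongrightarrow> l i"
    unfolding Cauchy_convergent_iff convergent_def by metis
  have "l \<longlonglongrightarrow> 0"
  proof (rule LIMSEQ_I)
    fix e :: real assume e: "0 < e"
    then obtain N where N: "\<And>m n. N \<le> m \<Longrightarrow> N \<le> n \<Longrightarrow> dist (x m) (x n) < e / 2"
      using metric_CauchyD[OF C, of "e / 2"] by auto
    have "norm (l i - 0) < e" if "N \<le> i" for i
    proof -
      have "0 \<le> l i" by (rule LIMSEQ_le_const[OF l[of i]]) auto
      moreover have "l i \<le> e / 2"
        using N[OF that] by (intro LIMSEQ_le_const2[OF l[of i]]) (auto intro: less_imp_le)
      ultimately show ?thesis using e by simp
    qed
    then show "\<exists>N. \<forall>i\<ge>N. norm (l i - 0) < e" by blast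
  qed
  then interpret settled_sequence x l 0 by unfold_locales (use assms l in auto)
  show ?thesis by (rule dipole_system_exists) (simp_all add: dist_le_rad_if_L_zero)
qed

lemma finite_weighted_bound:
  fixes F :: "(bool \<Rightarrow> 'a::metric_space \<times> real) set"
  assumes "finite F"
  shows "\<exists>R\<ge>0. \<forall>D\<in>F. \<forall>b. dist z (fst (D b)) + snd (D b) \<le> R"
proof -
  let ?A = "insert 0 ((\<lambda>(D, b). dist z (fst (D b)) + snd (D b)) ` (F \<times> UNIV))"
  have fin: "finite ?A" using assms by simp
  have "dist z (fst (D b)) + snd (D b) \<le> Max ?A" if "D \<in> F" for D b
    by (rule Max_ge[OF fin]) (use that in force)
  moreover have "0 \<le> Max ?A" by (rule Max_ge[OF fin]) simp
  ultimately show ?thesis by blast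
qed

text \<open>All dipoles share the point \<open>z\<close>, with a ball of radius \<open>0\<close>; the other centre is so far
  away that the room which its ball must leave for the earlier balls is a negligible part of the
  distance. The invariant \<open>snd (D b) \<le> dist z (fst (D b))\<close> keeps \<open>z\<close> outside the open
  earlier balls.\<close>

lemma dipole_system_of_unbounded:
  assumes unb: "\<not> bounded (UNIV :: 'a::metric_space set)" and \<epsilon>: "\<And>n. 0 < \<epsilon> n"
  shows "\<exists>D :: nat \<Rightarrow> bool \<Rightarrow> 'a \<times> real. dipole_system \<epsilon> D"
proof -
  fix z :: 'a
  let ?G = "\<lambda>n. {D :: bool \<Rightarrow> 'a \<times> real. dipole (\<epsilon> n) D \<and> (\<forall>b. snd (D b) \<le> dist z (fst (D b)))}"
  show ?thesis
  proof (rule dipole_system_by_choice[of ?G])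
    fix n F
    assume F: "finite F" "F \<subseteq> (\<Union>m. ?G m)"
    obtain R where R: "0 \<le> R" "\<And>D b. D \<in> F \<Longrightarrow> dist z (fst (D b)) + snd (D b) \<le> R"
      using finite_weighted_bound[OF F(1), of z] by blast
    obtain q where q: "max R (R / \<epsilon> n) < dist z q"
      using unb unfolding bounded_any_center[of UNIV z] by (meson UNIV_I not_le)
    have R_le: "R \<le> \<epsilon> n * dist z q" using q \<epsilon>[of n] by (simp add: field_simps)
    define D where "D = (\<lambda>b. if b then (q, dist z q - R) else (z, 0))"
    have "dipole (\<epsilon> n) D"
      using q R R_le by (auto simp: dipole_def D_def apart_def dist_commute algebra_simps)
    moreover have "snd (D b) \<le> dist z (fst (D b))" for b using R(1) by (simp add: D_def)
    moreover have "apart (E b) (D c)" if "E \<in> F" for E b c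
    proof (cases c)
      case True
      then show ?thesis
        using R(2)[OF that, of b] dist_triangle[of z q "fst (E b)"]
        by (simp add: apart_def D_def)
    next
      case False
      have "snd (E b) \<le> dist z (fst (E b))" using F(2) that by blast
      then show ?thesis using False by (simp add: apart_def D_def dist_commute)
    qed
    ultimately show "\<exists>D\<in>?G n. \<forall>E\<in>F. \<forall>b c. apart (E b) (D c)" by blast
  qed simp
qed

text \<open>Far out, distances in an ultrametric space are governed by the distance to \<open>z\<close>: if
  \<open>dist z p < dist z q\<close>, then \<open>dist p q = dist z q\<close>. With \<open>p\<close> far beyond the earlier balls and
  \<open>q\<close> farther still, the radii \<open>dist z p / 2\<close> and \<open>dist z q - dist z p / 2\<close> exhaust
  \<open>dist p q\<close> and leave room \<open>dist z p / 2\<close> for the earlier balls around either centre.\<close>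

lemma dipole_system_of_unbounded_ultrametric:
  fixes S :: "'a::metric_space set"
  assumes unb: "\<not> bounded S" and S: "ultrametric_on S"
  shows "\<exists>D :: nat \<Rightarrow> bool \<Rightarrow> 'a \<times> real. dipole_system (\<lambda>_. 0) D"
proof -
  obtain z where z: "z \<in> S" using unb by fastforce
  have far: "\<exists>p\<in>S. K < dist z p" for K
    using unb unfolding bounded_any_center[of S z] by (meson not_le)
  have um: "dist z q \<le> dist p q" if "p \<in> S" "q \<in> S" "dist z p < dist z q" for p q
    using S z that unfolding ultrametric_on_def by (metis max_def not_le)
  let ?G = "\<lambda>n::nat. {D :: bool \<Rightarrow> 'a \<times> real. dipole 0 D \<and> (\<forall>b. fst (D b) \<in> S)}"
  show ?thesis
  proof (rule dipole_system_by_choice[of ?G])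
    fix n :: nat and F
    assume F: "finite F" "F \<subseteq> (\<Union>m. ?G m)"
    obtain R where R: "0 \<le> R" "\<And>D b. D \<in> F \<Longrightarrow> dist z (fst (D b)) + snd (D b) \<le> R"
      using finite_weighted_bound[OF F(1), of z] by blast
    obtain p where p: "p \<in> S" "2 * R < dist z p" using far by blast
    obtain q where q: "q \<in> S" "dist z p < dist z q" using far by blast
    have pq: "dist p q = dist z q"
    proof (rule antisym)
      show "dist p q \<le> dist z q"
        using S z p(1) q unfolding ultrametric_on_def by (metis dist_commute less_imp_le max.absorb2)
    qed (rule um[OF p(1) q])
    define D where "D = (\<lambda>b. if b then (p, dist z p / 2) else (q, dist z q - dist z p / 2))"
    have "dipole 0 D"
      using q(2) pq zero_le_dist[of z p] zero_le_dist[of z q]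
      by (auto simp: dipole_def D_def apart_def simp del: zero_le_dist)
    moreover have "fst (D b) \<in> S" for b using p(1) q(1) by (simp add: D_def)
    moreover have "apart (E b) (D c)" if "E \<in> F" for E b c
    proof -
      have E: "fst (E b) \<in> S" "0 \<le> snd (E b)" using F(2) that by (auto simp: dipole_def)
      have le: "dist z (fst (E b)) + snd (E b) \<le> R" by (rule R(2)[OF that])
      then have "dist z (fst (E b)) < dist z p" "snd (E b) \<le> dist z p / 2"
        using E(2) p(2) R(1) zero_le_dist[of z "fst (E b)"] by linarith+
      then show ?thesis
        using um[OF E(1) p(1)] um[OF E(1) q(1)] q(2) by (auto simp: apart_def D_def)
    qed
    ultimately show "\<exists>D\<in>?G n. \<forall>E\<in>F. \<forall>b c. apart (E b) (D c)" by blast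
  qed simp
qed

lemma dipole_system_of_ultrametric:
  fixes S :: "'a::metric_space set"
  assumes "infinite S" and S: "ultrametric_on S"
  shows "\<exists>D :: nat \<Rightarrow> bool \<Rightarrow> 'a \<times> real. dipole_system (\<lambda>_. 0) D"
proof (cases "bounded S")
  case True
  obtain x l L where x: "settled_sequence x l L" "range x \<subseteq> S"
    using settled_sequence_of_bounded[OF True assms(1)] by blast
  interpret settled_sequence x l L by (rule x(1))
  have "ultrametric_on (range x)" using S x(2) unfolding ultrametric_on_def by blast
  then show ?thesis by (intro dipole_system_exists) (simp_all add: dist_le_rad_if_ultrametric)
qed (rule dipole_system_of_unbounded_ultrametric[OF _ S])

lemma dipole_system_of_infinite:
  assumes inf: "infinite (UNIV :: 'a::metric_space set)" and \<epsilon>: "\<And>n. 0 < \<epsilon> n"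
  shows "\<exists>D :: nat \<Rightarrow> bool \<Rightarrow> 'a \<times> real. dipole_system \<epsilon> D"
proof (cases "bounded (UNIV :: 'a set)")
  case True
  obtain x :: "nat \<Rightarrow> 'a" and l L where "settled_sequence x l L"
    using settled_sequence_of_bounded[OF True inf] by blast
  then interpret settled_sequence x l L .
  show ?thesis using \<epsilon> by (intro dipole_system_exists) (auto intro: less_imp_le)
qed (rule dipole_system_of_unbounded[OF _ \<epsilon>])

section \<open>Reduction from the completion to the space\<close>

text \<open>Only points of the space itself enter the dipoles. Density lets the accumulation point be
  approached by distinct points of the space.\<close>

lemma accumulation_point_imp_Cauchy:
  fixes p :: "'a::pointed_metric_space completion"
  assumes "p islimpt UNIV"
  shows "\<exists>x :: nat \<Rightarrow> 'a. inj x \<and> Cauchy x"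
proof -
  have inf: "infinite {x :: 'a. dist p (to_completion x) < e}" if "0 < e" for e
  proof -
    have "p islimpt range (to_completion :: 'a \<Rightarrow> _)"
      unfolding islimpt_def
    proof (intro allI impI)
      fix U :: "'a completion set" assume U: "p \<in> U" "open U"
      then obtain q where q: "q \<in> U - {p}" using assms unfolding islimpt_def by blast
      moreover have "open (U - {p})" using U(2) by (rule open_delete)
      ultimately show "\<exists>y\<in>range (to_completion :: 'a \<Rightarrow> _). y \<in> U \<and> y \<noteq> p"
        using open_Int_closure_eq_empty[of "U - {p}" "range to_completion"]
        unfolding dense_to_completion by blast
    qed
    then have "infinite (range to_completion \<inter> ball p e)"
      using that unfolding islimpt_eq_infinite_ball by blast
    moreover have "range to_completion \<inter> ball p e = to_completion ` {x :: 'a. dist p (to_completion x) < e}"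
      by auto
    ultimately show ?thesis using finite_imageI by fastforce
  qed
  have "\<exists>x. (\<forall>n. x n \<in> {x :: 'a. dist p (to_completion x) < inverse (Suc n)}) \<and> (\<forall>m n. m < n \<longrightarrow> x m \<noteq> x n)"
  proof (rule successive_choice)
    fix n and F :: "'a set" assume "finite F"
    then have "infinite ({x. dist p (to_completion x) < inverse (Suc n)} - F)"
      using inf by (intro Diff_infinite_finite) auto
    then show "\<exists>w\<in>{x. dist p (to_completion x) < inverse (Suc n)}. \<forall>v\<in>F. v \<noteq> w"
      using infinite_imp_nonempty by blast
  qed
  then obtain x where near: "\<And>n. dist p (to_completion (x n)) < inverse (Suc n)"
    and ne: "\<And>m n. m < n \<Longrightarrow> x m \<noteq> x n" by blast
  have "inj x" using ne by (metis injI nat_neq_iff)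
  moreover have "(\<lambda>n. to_completion (x n)) \<longlonglongrightarrow> p"
  proof (rule metric_tendsto_imp_tendsto[OF LIMSEQ_inverse_real_of_nat])
    show "\<forall>\<^sub>F n in sequentially. dist (to_completion (x n)) p \<le> dist (inverse (real (Suc n))) 0"
      using near by (intro always_eventually allI) (simp add: dist_commute less_imp_le)
  qed
  then have "Cauchy (\<lambda>n. to_completion (x n))" by (rule LIMSEQ_imp_Cauchy)
  then have "Cauchy x" by (simp add: Cauchy_def dist_to_completion)
  ultimately show ?thesis by blast
qed

text \<open>A point of the completion outside the dense image of the space would be an accumulation
  point.\<close>

lemma surj_to_completion:
  assumes "\<nexists>p :: 'a::pointed_metric_space completion. p islimpt UNIV"
  shows "surj (to_completion :: 'a \<Rightarrow> _)"
proof -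
  have "\<not> p islimpt range (to_completion :: 'a \<Rightarrow> _)" for p
    using assms islimpt_subset by blast
  then show ?thesis
    using dense_to_completion[where 'a = 'a] by (auto simp: closure_def)
qed

theorem theorem1:
  assumes "infinite (UNIV :: 'a::pointed_metric_space set)"
  shows "(\<exists>Y :: 'a lip0 set. subspace Y \<and> isometric_to Y TYPE(ell_inf)) \<and>
         ((\<exists>p :: 'a completion. p islimpt UNIV) \<or>
          (\<exists>S :: 'a completion set. infinite S \<and> ultrametric_on S) \<longrightarrow>
          (\<exists>Y :: 'a lip_free set. subspace Y \<and> isometric_to Y TYPE(ell1) \<and> one_complemented Y))"
proof (intro conjI impI)
  obtain D :: "nat \<Rightarrow> bool \<Rightarrow> 'a \<times> real" where "dipole_system (\<lambda>n. inverse (real (Suc n))) D"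
    using dipole_system_of_infinite[OF assms, of "\<lambda>n. inverse (real (Suc n))"] by auto
  then show "\<exists>Y :: 'a lip0 set. subspace Y \<and> isometric_to Y TYPE(ell_inf)"
    by (rule dipole_system_imp_ell_inf[OF _ LIMSEQ_inverse_real_of_nat])
next
  assume *: "(\<exists>p :: 'a completion. p islimpt UNIV) \<or>
    (\<exists>S :: 'a completion set. infinite S \<and> ultrametric_on S)"
  have "\<exists>D :: nat \<Rightarrow> bool \<Rightarrow> 'a \<times> real. dipole_system (\<lambda>_. 0) D"
  proof (cases "\<exists>p :: 'a completion. p islimpt UNIV")
    case True
    then show ?thesis using accumulation_point_imp_Cauchy dipole_system_of_Cauchy by blast
  next
    case False
    then obtain S :: "'a completion set" where S: "infinite S" "ultrametric_on S" using * by blast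
    let ?S = "to_completion -` S :: 'a set"
    have "to_completion ` ?S = S" using surj_to_completion[OF False] by (rule surj_image_vimage_eq)
    then have "infinite ?S" using S(1) by (metis finite_imageI)
    moreover have "ultrametric_on ?S"
      using S(2) unfolding ultrametric_on_def by (metis dist_to_completion vimage_eq)
    ultimately show ?thesis by (rule dipole_system_of_ultrametric)
  qed
  then show "\<exists>Y :: 'a lip_free set. subspace Y \<and> isometric_to Y TYPE(ell1) \<and> one_complemented Y"
    using dipole_system_imp_ell1 by blast
qed

end
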